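(* Let $m$ and $k$ be nonnegative integers. Then there are natural isomorphisms of species $$L_k\mathcal{C}^m \cong \mathsf{E}_k\circ \mathsf{L}_+^{\circ m}\circ \mathsf{E}_+ \qquad\text{and}\qquad L\mathcal{C}^m \cong \mathsf{E}\circ \mathsf{L}_+^{\circ m}\circ \mathsf{E}_+ .$$
   Context: A species is a functor $\mathsf{F}$ from the category $\mathbb{B}$ of finite sets and bijections to the category $\mathbb{E}$ of finite sets and maps; its value at a finite set $V$ is $\mathsf{F}[V]$, and $\mathsf{F}[n]:=\mathsf{F}[\{1,\dots,n\}]$. In the paper, $\mathsf{F}=\mathsf{G}$ for species means that there is a natural isomorphism between them. All species below act on bijections by the evident relabelling. Basic species: $\mathsf{E}$ (sets) is $\mathsf{E}[V]=\{V\}$; $\mathsf{L}$ (lists) is $\mathsf{L}[V]=\{(v_1,\dots,v_n): n=|V|,\ V=\{v_1,\dots,v_n\}\}$. For a species $\mathsf{F}$ and $k\ge 0$, $\mathsf{F}_k[V]=\mathsf{F}[V]$ if $|V|=k$ and $\varnothing$ otherwise; $\mathsf{F}_+$ satisfies $\mathsf{F}_+[\varnothing]=\varnothing$ and $\mathsf{F}_+[V]=\mathsf{F}[V]$ for $V\neq\varnothing$. Substitution: if $\mathsf{G}[\varnothing]=\varnothing$, then $(\mathsf{F}\circ\mathsf{G})[V]=\bigsqcup_{\pi}\bigl(\mathsf{F}[\pi]\times\prod_{B\in\pi}\mathsf{G}[B]\bigr)$, where $\pi$ runs over all set partitions of $V$ (into nonempty blocks; $\varnothing$ has exactly one set partition,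 the empty one). $\mathsf{L}_+^{\circ m}$ is the $m$-fold iterated substitution $\mathsf{L}_+\circ\cdots\circ\mathsf{L}_+$, with $\mathsf{L}_+^{\circ 0}=\mathsf{E}_1$, the identity for substitution. Arrangements: for a finite set $V$ and $m\ge 0$, the extended Catalan arrangement on $\mathbb{R}^V$ is the set of hyperplanes $\{x_u-x_v=a\}$ with $u\ne v$ in $V$ and $a$ an integer, $-m\le a\le m$; for $V=\{1,\dots,n\}$ it is $\mathcal{C}_n^m=\{\{x_i-x_j=a\}: 1\le i<j\le n,\ a\in\mathbb{Z},\ -m\le a\le m\}$ in $\mathbb{R}^n$. A flat of an arrangement $\mathcal{A}$ is a nonempty intersection of hyperplanes of $\mathcal{A}$ (including the ambient space as the empty intersection); $L(\mathcal{A})$ is the set of flats and $L_k(\mathcal{A})$ the set of flats of dimension $k$. $L\mathcal{C}^m$ (resp. $L_k\mathcal{C}^m$) is the species sending $V$ to the set of flats (resp. $k$-dimensional flats) of the extended Catalan arrangement in $\mathbb{R}^V$, so $L\mathcal{C}^m[n]=L(\mathcal{C}^m_n)$ and $L_k\mathcal{C}^m[n]=L_k(\mathcal{C}^m_n)$. *)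

theory Defs
  imports "HOL-Analysis.Analysis" "HOL-Analysis.Finite_Function_Topology" "HOL-Library.Disjoint_Sets"
begin

text \<open>
  A species is given on the category of finite subsets of an arbitrary label type \<open>'a\<close>, with
  structures in a type \<open>'s\<close>. A bijection \<open>V \<rightarrow> W\<close> is represented by its domain \<open>V\<close> and a
  function \<open>\<sigma> :: 'a \<Rightarrow> 'a\<close> with \<open>bij_betw \<sigma> V W\<close>; then \<open>transport F V \<sigma>\<close> is the map
  \<open>F[\<sigma>] : F[V] \<rightarrow> F[W]\<close>. Only the values of \<open>\<sigma>\<close> on \<open>V\<close> matter (third clause of \<open>species\<close>).
\<close>

record ('a, 's) species =
  struct :: "'a set \<Rightarrow> 's set"
  transport :: "'a set \<Rightarrow> ('a \<Rightarrow> 'a) \<Rightarrow> 's \<Rightarrow> 's"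

definition species :: "('a, 's) species \<Rightarrow> bool" where
  "species F \<longleftrightarrow>
     (\<forall>V. finite V \<longrightarrow> finite (struct F V)) \<and>
     (\<forall>V W \<sigma> s. finite V \<longrightarrow> bij_betw \<sigma> V W \<longrightarrow> s \<in> struct F V \<longrightarrow>
        transport F V \<sigma> s \<in> struct F W) \<and>
     (\<forall>V \<sigma> \<tau> s. finite V \<longrightarrow> inj_on \<sigma> V \<longrightarrow> (\<forall>v\<in>V. \<sigma> v = \<tau> v) \<longrightarrow> s \<in> struct F V \<longrightarrow>
        transport F V \<sigma> s = transport F V \<tau> s) \<and>
     (\<forall>V s. finite V \<longrightarrow> s \<in> struct F V \<longrightarrow> transport F V id s = s) \<and>
     (\<forall>V W X \<sigma> \<tau> s. finite V \<longrightarrow> bij_betw \<sigma> V W \<longrightarrow> bij_betw \<tau> W X \<longrightarrow> s \<in> struct F V \<longrightarrow>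
        transport F V (\<tau> \<circ> \<sigma>) s = transport F W \<tau> (transport F V \<sigma> s))"

definition natural_iso ::
  "('a, 's) species \<Rightarrow> ('a, 't) species \<Rightarrow> ('a set \<Rightarrow> 's \<Rightarrow> 't) \<Rightarrow> bool" where
  "natural_iso F G \<eta> \<longleftrightarrow>
     (\<forall>V. finite V \<longrightarrow> bij_betw (\<eta> V) (struct F V) (struct G V)) \<and>
     (\<forall>V W \<sigma> s. finite V \<longrightarrow> bij_betw \<sigma> V W \<longrightarrow> s \<in> struct F V \<longrightarrow>
        \<eta> W (transport F V \<sigma> s) = transport G V \<sigma> (\<eta> V s))"

definition species_iso :: "('a, 's) species \<Rightarrow> ('a, 't) species \<Rightarrow> bool" (infix "\<cong>\<^sub>S" 50) where
  "F \<cong>\<^sub>S G \<longleftrightarrow> species F \<and> species G \<and> (\<exists>\<eta>. natural_iso F G \<eta>)"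

definition set_species :: "('a, 'a set) species" where
  "set_species = \<lparr>struct = (\<lambda>V. {V}), transport = (\<lambda>V \<sigma> S. \<sigma> ` S)\<rparr>"

definition list_species :: "('a, 'a list) species" where
  "list_species =
     \<lparr>struct = (\<lambda>V. {xs. distinct xs \<and> set xs = V}), transport = (\<lambda>V \<sigma> xs. map \<sigma> xs)\<rparr>"

definition of_card :: "nat \<Rightarrow> ('a, 's) species \<Rightarrow> ('a, 's) species" where
  "of_card k F = F\<lparr>struct := (\<lambda>V. if card V = k then struct F V else {})\<rparr>"

definition nonempty :: "('a, 's) species \<Rightarrow> ('a, 's) species" where
  "nonempty F = F\<lparr>struct := (\<lambda>V. if V = {} then {} else struct F V)\<rparr>"

text \<open>
  The outer species lives on the label type \<open>'a set\<close>, since it is evaluated at set partitions.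
  Elements of the product over the blocks are extensional functions. Along \<open>\<sigma>\<close>, a block \<open>B\<close>
  goes to \<open>\<sigma> ` B\<close>; conversely a block \<open>C\<close> of the image partition comes from
  \<open>{v \<in> V. \<sigma> v \<in> C}\<close>. The operation is meant for \<open>G\<close> without structures on \<open>{}\<close>.
\<close>

definition subst ::
  "('a set, 't) species \<Rightarrow> ('a, 's) species \<Rightarrow> ('a, 'a set set \<times> 't \<times> ('a set \<Rightarrow> 's)) species"
  (infixr "\<circ>\<^sub>S" 60) where
  "F \<circ>\<^sub>S G =
     \<lparr>struct = (\<lambda>V. SIGMA \<pi>:{\<pi>. partition_on V \<pi>}. struct F \<pi> \<times> (\<Pi>\<^sub>E B\<in>\<pi>. struct G B)),
      transport = (\<lambda>V \<sigma> (\<pi>, f, g).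
        ((`) \<sigma> ` \<pi>,
         transport F \<pi> ((`) \<sigma>) f,
         (\<lambda>C\<in>(`) \<sigma> ` \<pi>. let B = {v\<in>V. \<sigma> v \<in> C} in transport G B \<sigma> (g B))))\<rparr>"

text \<open>
  The type of structures of \<open>F \<circ>\<^sub>S (F \<circ>\<^sub>S \<dots>)\<close> depends on the number of factors. To define the
  iterate by recursion on that number, all levels are collected in one datatype, and the
  structures of \<open>F \<circ>\<^sub>S G\<close> are carried over along the injective constructor \<open>Level\<close>.
\<close>

datatype ('a, 't) iterated =
  Base (the_base: "'a set")
| Level (the_level: "'a set set \<times> 't \<times> ('a set \<Rightarrow> ('a, 't) iterated)")

definition rename :: "('s \<Rightarrow> 't) \<Rightarrow> ('t \<Rightarrow> 's) \<Rightarrow> ('a, 's) species \<Rightarrow> ('a, 't) species" where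
  "rename c d F =
     \<lparr>struct = (\<lambda>V. c ` struct F V), transport = (\<lambda>V \<sigma> s. c (transport F V \<sigma> (d s)))\<rparr>"

fun iterate :: "('a set, 't) species \<Rightarrow> nat \<Rightarrow> ('a, ('a, 't) iterated) species" where
  "iterate F 0 = rename Base the_base (of_card 1 set_species)"
| "iterate F (Suc m) = rename Level the_level (F \<circ>\<^sub>S iterate F m)"

text \<open>
  For finite \<open>V\<close>, the space of real functions on \<open>V\<close> is represented by the finitely supported
  functions on \<open>'a\<close> with support in \<open>V\<close>, a linear subspace of the real vector space
  \<open>'a \<Rightarrow>\<^sub>0 real\<close>.
\<close>

definition space_on :: "'a set \<Rightarrow> ('a \<Rightarrow>\<^sub>0 real) set" where
  "space_on V = {x. Poly_Mapping.keys x \<subseteq> V}"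

definition hyperplane :: "'a set \<Rightarrow> 'a \<Rightarrow> 'a \<Rightarrow> int \<Rightarrow> ('a \<Rightarrow>\<^sub>0 real) set" where
  "hyperplane V u v a =
     {x \<in> space_on V. Poly_Mapping.lookup x u - Poly_Mapping.lookup x v = of_int a}"

definition catalan_arrangement :: "nat \<Rightarrow> 'a set \<Rightarrow> ('a \<Rightarrow>\<^sub>0 real) set set" where
  "catalan_arrangement m V =
     {hyperplane V u v a | u v a. u \<in> V \<and> v \<in> V \<and> u \<noteq> v \<and> - int m \<le> a \<and> a \<le> int m}"

definition flats :: "'v set \<Rightarrow> 'v set set \<Rightarrow> 'v set set" where
  "flats S \<A> = {X. X \<noteq> {} \<and> (\<exists>\<H>\<subseteq>\<A>. X = S \<inter> \<Inter>\<H>)}"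

text \<open>The dimension of a nonempty affine subspace is the dimension of its direction space.\<close>

definition flat_dim :: "'v::real_vector set \<Rightarrow> nat" where
  "flat_dim X = dim {x - y | x y. x \<in> X \<and> y \<in> X}"

text \<open>The point \<open>x\<close> is relabelled to the point \<open>y\<close> whose coordinate at \<open>\<sigma> v\<close> is that of \<open>x\<close> at \<open>v\<close>.\<close>

definition relabel :: "'a set \<Rightarrow> ('a \<Rightarrow> 'a) \<Rightarrow> ('a \<Rightarrow>\<^sub>0 real) set \<Rightarrow> ('a \<Rightarrow>\<^sub>0 real) set" where
  "relabel V \<sigma> X =
     {y \<in> space_on (\<sigma> ` V).
        \<exists>x\<in>X. \<forall>v\<in>V. Poly_Mapping.lookup y (\<sigma> v) = Poly_Mapping.lookup x v}"

definition catalan_flats :: "nat \<Rightarrow> ('a, ('a \<Rightarrow>\<^sub>0 real) set) species" where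
  "catalan_flats m =
     \<lparr>struct = (\<lambda>V. flats (space_on V) (catalan_arrangement m V)), transport = relabel\<rparr>"

definition catalan_flats_of_dim :: "nat \<Rightarrow> nat \<Rightarrow> ('a, ('a \<Rightarrow>\<^sub>0 real) set) species" where
  "catalan_flats_of_dim k m =
     \<lparr>struct = (\<lambda>V. {X \<in> flats (space_on V) (catalan_arrangement m V). flat_dim X = k}),
      transport = relabel\<rparr>"

text \<open>Restriction, substitution and iteration preserve the functor laws.\<close>

lemma species_set: "species set_species"
  by (auto simp: species_def set_species_def bij_betw_def)

lemma species_list: "species list_species"
proof -
  have "finite {xs. distinct xs \<and> set xs = V}" if "finite V" for V :: "'a set"
    by (rule finite_subset[OF _ finite_subset_distinct[OF that]]) auto
  then show ?thesis
    by (auto simp: species_def list_species_def bij_betw_def distinct_map)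
qed

lemma
  assumes "species F"
  shows species_finite: "finite V \<Longrightarrow> finite (struct F V)"
    and species_mem: "finite V \<Longrightarrow> bij_betw \<sigma> V W \<Longrightarrow>
      s \<in> struct F V \<Longrightarrow>
      transport F V \<sigma> s \<in> struct F W"
    and species_cong: "finite V \<Longrightarrow> inj_on \<sigma> V \<Longrightarrow>
      (\<And>v. v \<in> V \<Longrightarrow> \<sigma> v = \<tau> v) \<Longrightarrow>
      s \<in> struct F V \<Longrightarrow> transport F V \<sigma> s = transport F V \<tau> s"
    and species_id: "finite V \<Longrightarrow> s \<in> struct F V \<Longrightarrow>
      transport F V id s = s"
    and species_comp: "finite V \<Longrightarrow> bij_betw \<sigma> V W \<Longrightarrow>
      bij_betw \<tau> W X \<Longrightarrow> s \<in> struct F V \<Longrightarrow>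
      transport F V (\<tau> \<circ> \<sigma>) s = transport F W \<tau> (transport F V \<sigma> s)"
proof -
  note F = assms[unfolded species_def]
  note F2 = F[THEN conjunct2] note F3 = F2[THEN conjunct2] note F4 = F3[THEN conjunct2]
  show "finite V \<Longrightarrow> finite (struct F V)"
    using F[THEN conjunct1] by (rule allE) (erule mp)
  show "finite V \<Longrightarrow> bij_betw \<sigma> V W \<Longrightarrow>
    s \<in> struct F V \<Longrightarrow> transport F V \<sigma> s \<in> struct F W"
    using F2[THEN conjunct1, rule_format, of V \<sigma> W s] .
  show "finite V \<Longrightarrow> inj_on \<sigma> V \<Longrightarrow>
    (\<And>v. v \<in> V \<Longrightarrow> \<sigma> v = \<tau> v) \<Longrightarrow>
      s \<in> struct F V \<Longrightarrow> transport F V \<sigma> s = transport F V \<tau> s"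
    using F3[THEN conjunct1, rule_format, of V \<sigma> \<tau> s] .
  show "finite V \<Longrightarrow> s \<in> struct F V \<Longrightarrow> transport F V id s = s"
    using F4[THEN conjunct1, rule_format, of V s] .
  show "finite V \<Longrightarrow> bij_betw \<sigma> V W \<Longrightarrow>
    bij_betw \<tau> W X \<Longrightarrow> s \<in> struct F V \<Longrightarrow>
      transport F V (\<tau> \<circ> \<sigma>) s = transport F W \<tau> (transport F V \<sigma> s)"
    using F4[THEN conjunct2, rule_format, of V \<sigma> W \<tau> X s] .
qed

lemma species_restrict:
  assumes F: "species F"
    and P: "\<And>V W \<sigma>. finite V \<Longrightarrow> bij_betw \<sigma> V W \<Longrightarrow>
      P V \<Longrightarrow> P W"
    and G: "\<And>V. struct G V = (if P V then struct F V else {})" "transport G = transport F"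
  shows "species G"
proof -
  have m: "s \<in> struct G V \<longleftrightarrow> P V \<and> s \<in> struct F V" for s V
    by (simp add: G(1))
  have f: "finite (struct G V)" if "finite V" for V
    using species_finite[OF F that] by (simp add: G(1))
  show ?thesis
    unfolding species_def m G(2)
    by (intro conjI allI impI; (elim conjE)?)
      (blast intro: f P species_mem[OF F] species_cong[OF F] species_id[OF F] species_comp[OF F])+
qed

lemma species_of_card: "species F \<Longrightarrow> species (of_card k F)"
  by (rule species_restrict[where P="\<lambda>V. card V = k"])
    (auto simp: of_card_def dest: bij_betw_same_card)

lemma species_nonempty: "species F \<Longrightarrow> species (nonempty F)"
  by (rule species_restrict[where P="\<lambda>V. V \<noteq> {}"])
    (auto simp: nonempty_def bij_betw_def)

lemma species_rename:
  assumes F: "species F" and d: "\<And>x. d (c x) = x"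
  shows "species (rename c d F)"
  unfolding species_def rename_def
  by (auto simp: d intro: species_finite[OF F] species_mem[OF F])
    (metis species_cong[OF F] species_id[OF F] species_comp[OF F])+

lemma partition_block: "partition_on V \<pi> \<Longrightarrow> B \<in> \<pi> \<Longrightarrow>
  B \<subseteq> V"
  by (auto simp: partition_on_def)

lemma preimage_block: "inj_on \<sigma> V \<Longrightarrow> B \<subseteq> V \<Longrightarrow>
  {v\<in>V. \<sigma> v \<in> \<sigma> ` B} = B"
  by (auto simp: inj_on_def)

lemma inj_on_image_blocks: "inj_on \<sigma> V \<Longrightarrow>
  partition_on V \<pi> \<Longrightarrow> inj_on ((`) \<sigma>) \<pi>"
  by (meson inj_on_image_eq_iff inj_onI partition_block)

lemma partition_on_image_blocks:
  assumes "bij_betw \<sigma> V W" and "partition_on V \<pi>"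
  shows "partition_on W ((`) \<sigma> ` \<pi>)"
proof -
  have "{} \<notin> (`) \<sigma> ` \<pi>" using partition_onD3[OF assms(2)] by auto
  then have "(`) \<sigma> ` \<pi> - {{}} = (`) \<sigma> ` \<pi>" by simp
  then show ?thesis
    using partition_on_inj_image[OF assms(2), of \<sigma>] assms(1) by (simp add: bij_betw_def)
qed

lemma subst_mem:
  "(\<pi>, f, g) \<in> struct (F \<circ>\<^sub>S G) V \<longleftrightarrow>
    partition_on V \<pi> \<and> f \<in> struct F \<pi> \<and> g \<in> (\<Pi>\<^sub>E B\<in>\<pi>. struct G B)"
  by (simp add: subst_def)

lemma subst_transport:
  assumes "inj_on \<sigma> V" and "partition_on V \<pi>"
  obtains h where
    "transport (F \<circ>\<^sub>S G) V \<sigma> (\<pi>, f, g) = ((`) \<sigma> ` \<pi>,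
      transport F \<pi> ((`) \<sigma>) f, h)"
    "h \<in> extensional ((`) \<sigma> ` \<pi>)"
    "\<And>B. B \<in> \<pi> \<Longrightarrow> h (\<sigma> ` B) = transport G B \<sigma> (g B)"
proof
  let ?h = "\<lambda>C\<in>(`) \<sigma> ` \<pi>. let B
    = {v\<in>V. \<sigma> v \<in> C} in transport G B \<sigma> (g B)"
  show "transport (F \<circ>\<^sub>S G) V \<sigma> (\<pi>, f, g) = ((`) \<sigma> ` \<pi>,
    transport F \<pi> ((`) \<sigma>) f, ?h)"
    by (simp add: subst_def)
  show "?h \<in> extensional ((`) \<sigma> ` \<pi>)" by (rule restrict_extensional)
  show "?h (\<sigma> ` B) = transport G B \<sigma> (g B)" if B: "B \<in> \<pi>" for B
    unfolding restrict_apply'[OF imageI[OF B]] Let_def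
      preimage_block[OF assms(1) partition_block[OF assms(2) B]] ..
qed

lemma subst_transport_eqI:
  assumes "inj_on \<sigma> V" and "partition_on V \<pi>"
    and h: "h \<in> extensional ((`) \<sigma> ` \<pi>)"
    and eq: "\<And>B. B \<in> \<pi> \<Longrightarrow>
      h (\<sigma> ` B) = transport G B \<sigma> (g B)"
  shows "transport (F \<circ>\<^sub>S G) V \<sigma> (\<pi>, f, g) = ((`) \<sigma> ` \<pi>,
    transport F \<pi> ((`) \<sigma>) f, h)"
proof -
  obtain h' where h': "transport (F \<circ>\<^sub>S G) V \<sigma> (\<pi>, f,
    g) = ((`) \<sigma> ` \<pi>, transport F \<pi> ((`) \<sigma>) f, h')"
    "h' \<in> extensional ((`) \<sigma> ` \<pi>)"
    "\<And>B. B \<in> \<pi> \<Longrightarrow> h' (\<sigma> ` B) = transport G B \<sigma> (g B)"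
    using subst_transport[OF assms(1,2), of F G f g] by blast
  have "h' = h"
    using h'(2) h by (rule extensionalityI) (auto simp: h'(3) eq)
  with h'(1) show ?thesis by simp
qed

lemma species_subst:
  assumes F: "species F" and G: "species G"
  shows "species (F \<circ>\<^sub>S G)"
  unfolding species_def
proof (intro conjI allI impI)
  fix V :: "'a set" assume V: "finite V"
  have "finite (struct F \<pi> \<times> (\<Pi>\<^sub>E B\<in>\<pi>. struct G B))" if "partition_on V \<pi>" for \<pi>
    using finite_elements[OF V that] finite_subset[OF partition_block[OF that] V]
    by (intro finite_cartesian_product finite_PiE species_finite[OF F] species_finite[OF G])
  then show "finite (struct (F \<circ>\<^sub>S G) V)"
    using V by (auto simp: subst_def finitely_many_partition_on)
next
  fix V W :: "'a set" and \<sigma> :: "'a \<Rightarrow> 'a" and s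
  assume V: "finite V" and b: "bij_betw \<sigma> V W"
    and s: "s \<in> struct (F \<circ>\<^sub>S G) V"
  obtain \<pi> f g where s': "s = (\<pi>,f,g)" by (cases s)
  then have p: "partition_on V \<pi>" "f \<in> struct F \<pi>"
    "g \<in> (\<Pi>\<^sub>E B\<in>\<pi>. struct G B)" using s by (auto simp: subst_mem)
  have i: "inj_on \<sigma> V" using b by (auto simp: bij_betw_def)
  obtain h where h: "transport (F \<circ>\<^sub>S G) V \<sigma> (\<pi>,f,g) = ((`) \<sigma> ` \<pi>,
    transport F \<pi> ((`) \<sigma>) f, h)" "h \<in> extensional ((`) \<sigma> ` \<pi>)"
  "\<And>B. B\<in>\<pi> \<Longrightarrow> h (\<sigma> ` B) = transport G B \<sigma> (g B)"
    by (rule subst_transport[OF i p(1), where F=F and G=G and f=f and g=g]) blast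
  have "transport F \<pi> ((`) \<sigma>) f \<in> struct F ((`) \<sigma> ` \<pi>)"
    using p finite_elements[OF V p(1)] inj_on_image_blocks[OF i p(1)]
      by (intro species_mem[OF F]) (auto simp: bij_betw_def)
  moreover have "h (\<sigma> ` B) \<in> struct G (\<sigma> ` B)" if "B \<in> \<pi>" for B
    unfolding h(3)[OF that]
      using p that V partition_block[OF p(1) that]
        finite_subset[OF partition_block[OF p(1) that] V] i
    by (intro species_mem[OF G]) (auto simp: bij_betw_def intro: inj_on_subset)
  ultimately show "transport (F \<circ>\<^sub>S G) V \<sigma> s \<in> struct (F \<circ>\<^sub>S G) W"
    using h partition_on_image_blocks[OF b p(1)] by (auto simp: s' subst_mem PiE_def)
next
  fix V :: "'a set" and \<sigma> \<tau> :: "'a \<Rightarrow> 'a" and s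
  assume V: "finite V" and i: "inj_on \<sigma> V" and e: "\<forall>v\<in>V. \<sigma> v = \<tau> v"
    and s: "s \<in> struct (F \<circ>\<^sub>S G) V"
  obtain \<pi> f g where s': "s = (\<pi>,f,g)" by (cases s)
  then have p: "partition_on V \<pi>" "f \<in> struct F \<pi>"
    "g \<in> (\<Pi>\<^sub>E B\<in>\<pi>. struct G B)" using s by (auto simp: subst_mem)
  have i': "inj_on \<tau> V" using i e by (simp cong: inj_on_cong)
  have ei: "\<sigma> ` B = \<tau> ` B" if "B \<in> \<pi>" for B
    using partition_block[OF p(1) that] e by (auto intro!: image_cong)
  obtain h where h: "transport (F \<circ>\<^sub>S G) V \<sigma> (\<pi>,f,g) = ((`) \<sigma> ` \<pi>,
    transport F \<pi> ((`) \<sigma>) f, h)" "h \<in> extensional ((`) \<sigma> ` \<pi>)"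
  "\<And>B. B\<in>\<pi> \<Longrightarrow> h (\<sigma> ` B) = transport G B \<sigma> (g B)"
    by (rule subst_transport[OF i p(1), where F=F and G=G and f=f and g=g]) blast
  have im: "(`) \<sigma> ` \<pi> = (`) \<tau> ` \<pi>" using ei by (auto intro!: image_cong)
  have t: "transport F \<pi> ((`) \<sigma>) f = transport F \<pi> ((`) \<tau>) f"
    using p ei finite_elements[OF V p(1)] inj_on_image_blocks[OF i p(1)]
      by (intro species_cong[OF F]) auto
  have "h (\<tau> ` B) = transport G B \<tau> (g B)" if "B \<in> \<pi>" for B
    unfolding ei[OF that, symmetric] h(3)[OF that]
      using p that V partition_block[OF p(1) that]
        finite_subset[OF partition_block[OF p(1) that] V] i e
    by (intro species_cong[OF G]) (auto intro: inj_on_subset)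
  then have "transport (F \<circ>\<^sub>S G) V \<tau> (\<pi>,f,g) = ((`) \<tau> ` \<pi>,
    transport F \<pi> ((`) \<tau>) f, h)"
    using h(2) im by (intro subst_transport_eqI[OF i' p(1)]) auto
  then show "transport (F \<circ>\<^sub>S G) V \<sigma> s
    = transport (F \<circ>\<^sub>S G) V \<tau> s"
    using h(1) im t s' by simp
next
  fix V :: "'a set" and s assume V: "finite V" and s: "s \<in> struct (F \<circ>\<^sub>S G) V"
  obtain \<pi> f g where s': "s = (\<pi>,f,g)" by (cases s)
  then have p: "partition_on V \<pi>" "f \<in> struct F \<pi>"
    "g \<in> (\<Pi>\<^sub>E B\<in>\<pi>. struct G B)" using s by (auto simp: subst_mem)
  have im: "(`) id = (id :: 'a set \<Rightarrow> 'a set)" by auto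
  have t: "transport F \<pi> id f = f" using p finite_elements[OF V p(1)]
    by (intro species_id[OF F])
  have "transport G B id (g B) = g B" if "B \<in> \<pi>" for B
    using p that V finite_subset[OF partition_block[OF p(1) that] V]
      by (intro species_id[OF G]) auto
  then have "transport (F \<circ>\<^sub>S G) V id (\<pi>,f,g) = ((`) id ` \<pi>,
    transport F \<pi> ((`) id) f, g)"
    using p by (intro subst_transport_eqI) (auto simp: im PiE_def)
  then show "transport (F \<circ>\<^sub>S G) V id s = s" using s' t by (simp add: im)
next
  fix V W X :: "'a set" and \<sigma> \<tau> :: "'a \<Rightarrow> 'a" and s
  assume V: "finite V" and b: "bij_betw \<sigma> V W" and c: "bij_betw \<tau> W X"
    and s: "s \<in> struct (F \<circ>\<^sub>S G) V"
  obtain \<pi> f g where s': "s = (\<pi>,f,g)" by (cases s)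
  then have p: "partition_on V \<pi>" "f \<in> struct F \<pi>"
    "g \<in> (\<Pi>\<^sub>E B\<in>\<pi>. struct G B)" using s by (auto simp: subst_mem)
  have i: "inj_on \<sigma> V" "inj_on \<tau> W" "inj_on (\<tau> \<circ> \<sigma>) V"
    "\<sigma> ` V = W" using b c by (auto simp: bij_betw_def comp_inj_on)
  note q = partition_on_image_blocks[OF b p(1)]
  obtain h where h: "transport (F \<circ>\<^sub>S G) V \<sigma> (\<pi>,f,g) = ((`) \<sigma> ` \<pi>,
    transport F \<pi> ((`) \<sigma>) f, h)" "h \<in> extensional ((`) \<sigma> ` \<pi>)"
  "\<And>B. B\<in>\<pi> \<Longrightarrow> h (\<sigma> ` B) = transport G B \<sigma> (g B)"
    by (rule subst_transport[OF i(1) p(1), where F=F and G=G and f=f and g=g]) blast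
  obtain h' where h': "transport (F \<circ>\<^sub>S G) W \<tau> ((`) \<sigma> ` \<pi>,
    transport F \<pi> ((`) \<sigma>) f, h) = ((`) \<tau> ` (`) \<sigma> ` \<pi>,
      transport F ((`) \<sigma> ` \<pi>) ((`) \<tau>) (transport F \<pi> ((`) \<sigma>) f), h')"
        "h' \<in> extensional ((`) \<tau> ` (`) \<sigma> ` \<pi>)"
  "\<And>B. B\<in>(`) \<sigma> ` \<pi> \<Longrightarrow>
    h' (\<tau> ` B) = transport G B \<tau> (h B)"
      by (rule subst_transport[OF i(2) q,
        where F=F and G=G and f="transport F \<pi> ((`) \<sigma>) f" and g=h]) blast
  have im: "(`) (\<tau> \<circ> \<sigma>) = ((`) \<tau> \<circ> (`) \<sigma>)"
    by (auto simp: image_comp)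
  have t: "transport F \<pi> ((`) \<tau> \<circ> (`) \<sigma>) f
    = transport F ((`) \<sigma> ` \<pi>) ((`) \<tau>) (transport F \<pi> ((`) \<sigma>) f)"
    using p finite_elements[OF V p(1)] inj_on_image_blocks[OF i(1) p(1)]
      inj_on_image_blocks[OF i(2) q]
    by (intro species_comp[OF F, where X="(`) \<tau> ` (`) \<sigma> ` \<pi>"])
      (auto simp: bij_betw_def)
  have "h' (\<tau> ` \<sigma> ` B) = transport G B (\<tau> \<circ> \<sigma>)
    (g B)" if "B \<in> \<pi>" for B
  proof -
    have "h' (\<tau> ` \<sigma> ` B)
      = transport G (\<sigma> ` B) \<tau> (transport G B \<sigma> (g B))" using h' h that by auto
    also have "\<dots> = transport G B (\<tau> \<circ> \<sigma>) (g B)"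
      using p that V partition_block[OF p(1) that]
        finite_subset[OF partition_block[OF p(1) that] V] i
      by (intro species_comp[OF G, symmetric, where X="\<tau> ` \<sigma> ` B"])
        (auto simp: bij_betw_def intro: inj_on_subset)
    finally show ?thesis .
  qed
  then have "transport (F \<circ>\<^sub>S G) V (\<tau> \<circ> \<sigma>) (\<pi>,f,g) = ((`)
    (\<tau> \<circ> \<sigma>) ` \<pi>, transport F \<pi> ((`) (\<tau> \<circ> \<sigma>)) f, h')"
    using h'(2) by (intro subst_transport_eqI[OF i(3) p(1)]) (auto simp: im image_comp)
  then show "transport (F \<circ>\<^sub>S G) V (\<tau> \<circ> \<sigma>) s
    = transport (F \<circ>\<^sub>S G) W \<tau> (transport (F \<circ>\<^sub>S G) V \<sigma> s)"
    using t by (simp add: s' h(1) h'(1) im image_comp)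
qed

lemma species_iterate: "species F \<Longrightarrow> species (iterate F m)"
  by (induction m) (simp_all add: species_rename species_of_card species_set species_subst)

end

theory Submission
  imports Defs
begin

text \<open>
  A point of the space of functions on \<open>V\<close> is a configuration of particles on the line, labelled by
  \<open>V\<close>. A flat fixes some of the differences between the particles: it consists of a partition of \<open>V\<close>
  into blocks, each of which moves as a rigid body, independently of the others, and of the shape of
  each block up to translation. The dimension of the flat is the number of blocks. A shape is
  possible exactly when the block is connected by differences that are integers of absolute value at
  most \<open>m\<close>, since these are the differences that hyperplanes can fix
  (\<open>rigid_flat_is_flat\<close>, \<open>flat_is_rigid_flat\<close>, \<open>flat_dim_rigid_flat\<close>). The blocks account for the
  factor of sets, or of \<open>k\<close>-element sets, on the left of the theorem.

  In a connected shape, particles may coincide. Grouping them leaves an injective connected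
  configuration of the groups, and the groups account for the factor of nonempty sets on the right
  (\<open>fits_ex1\<close>).

  It remains to identify injective connected configurations, up to translation, with \<open>m\<close>-fold
  iterated nonempty lists. In such a configuration for \<open>m + 1\<close>, consecutive particles differ by an
  integer between \<open>1\<close> and \<open>m + 1\<close>. Cutting at the gaps equal to \<open>m + 1\<close> leaves a nonempty list of
  connected configurations for \<open>m\<close>; conversely such a list is glued in a unique way, up to
  translation, by placing each block at distance \<open>m + 1\<close> after the previous one. Induction on \<open>m\<close>
  gives the correspondence (\<open>placed_exists\<close>, \<open>placed_unique\<close>, \<open>placed_connected\<close>, \<open>placed_ex1\<close>).
  For \<open>m = 0\<close> a single particle remains, which is the identity for substitution.

  The correspondence is phrased throughout as a relation between structures and configurations that
  is compatible with relabelling (\<open>placed_transport\<close>, \<open>fits_transport\<close>). Naturality of the resulting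
  bijection between structures and flats follows (\<open>bij_betw_realization\<close>, \<open>realization_transport\<close>).
\<close>

section \<open>Configurations with linked particles\<close>

text \<open>
  A point \<open>x\<close> is seen as a configuration of labelled particles on the real line. Two particles are
  linked when some hyperplane of the arrangement for their labels contains the point, or when
  they are equal: the case \<open>u = v\<close> is included, which only adds loops to the graph.
\<close>

definition linked :: "nat \<Rightarrow> 'a set \<Rightarrow> ('a \<Rightarrow> real) \<Rightarrow> 'a rel" where
  "linked m V x =
     {(u, v). u \<in> V \<and> v \<in> V \<and> (\<exists>a::int. \<bar>a\<bar> \<le> int m \<and> x u - x v = of_int a)}"

definition connected_by :: "nat \<Rightarrow> 'a set \<Rightarrow> ('a \<Rightarrow> real) \<Rightarrow> bool" where
  "connected_by m V x \<longleftrightarrow> V \<noteq> {} \<and> (\<forall>u\<in>V. \<forall>v\<in>V. (u, v) \<in> (linked m V x)\<^sup>*)"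

definition components :: "'a rel \<Rightarrow> 'a set \<Rightarrow> 'a set set" where
  "components r V = (\<lambda>u. r\<^sup>* `` {u}) ` V"

lemma linked_sym: "sym (linked m V x)"
proof (rule symI)
  fix u v assume "(u, v) \<in> linked m V x"
  then obtain a :: int where a: "u \<in> V" "v \<in> V" "\<bar>a\<bar> \<le> int m" "x u - x v = of_int a"
    by (auto simp: linked_def)
  then have "\<bar>- a\<bar> \<le> int m \<and> x v - x u = of_int (- a)" by auto
  then show "(v, u) \<in> linked m V x" using a unfolding linked_def by blast
qed

lemma linked_mono: "m \<le> n \<Longrightarrow> U \<subseteq> V \<Longrightarrow> linked m U x \<subseteq> linked n V x"
  unfolding linked_def by fastforce

lemma connected_by_mono: "connected_by m V x \<Longrightarrow> m \<le> n \<Longrightarrow> connected_by n V x"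
  unfolding connected_by_def using rtrancl_mono[OF linked_mono[of m n V V x]] by blast

lemma connected_by_diff_int:
  assumes "connected_by m V x" "u \<in> V" "v \<in> V"
  obtains a :: int where "x u - x v = of_int a"
proof -
  have "(u, v) \<in> (linked m V x)\<^sup>*" using assms by (auto simp: connected_by_def)
  then have "\<exists>a::int. x u - x v = of_int a"
  proof induction
    case base show ?case by (intro exI[of _ 0]) simp
  next
    case (step v w)
    then obtain a b :: int where "x u - x v = of_int a" "x v - x w = of_int b"
      by (auto simp: linked_def)
    then have "x u - x w = of_int (a + b)" by simp
    then show ?case ..
  qed
  then show ?thesis using that by blast
qed

lemma connected_by_union:
  assumes A: "connected_by m A x" and B: "connected_by m B x"
    and a: "a \<in> A" "b \<in> B" "x b = x a + real m"
  shows "connected_by m (A \<union> B) x"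
proof -
  let ?r = "linked m (A \<union> B) x"
  have ab: "(a, b) \<in> ?r"
    using a unfolding linked_def by (auto intro!: exI[of _ "- int m"])
  have sym: "sym (?r\<^sup>*)" by (intro sym_rtrancl linked_sym)
  have "(linked m A x)\<^sup>* \<subseteq> ?r\<^sup>*" "(linked m B x)\<^sup>* \<subseteq> ?r\<^sup>*"
    by (intro rtrancl_mono linked_mono; simp)+
  then have *: "\<forall>u\<in>A. (a, u) \<in> ?r\<^sup>*" "\<forall>u\<in>B. (b, u) \<in> ?r\<^sup>*"
    using A B a unfolding connected_by_def by blast+
  have from_a: "(a, u) \<in> ?r\<^sup>*" if "u \<in> A \<union> B" for u
    using that
  proof
    assume "u \<in> B"
    with *(2) have "(b, u) \<in> ?r\<^sup>*" by blast
    with ab show ?thesis by (rule converse_rtrancl_into_rtrancl)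
  qed (use *(1) in blast)
  have "(u, v) \<in> ?r\<^sup>*" if "u \<in> A \<union> B" "v \<in> A \<union> B" for u v
    using symD[OF sym from_a[OF that(1)]] from_a[OF that(2)] by (rule rtrancl_trans)
  then show ?thesis
    unfolding connected_by_def using a(1) by blast
qed

text \<open>
  A path that starts in \<open>A\<close> and ends outside crosses the boundary of \<open>A\<close>.
\<close>

lemma connected_by_cut:
  assumes c: "connected_by m V x" and "A \<subseteq> V" "u \<in> A" "v \<in> V" "v \<notin> A"
  obtains p q where "p \<in> A" "q \<in> V - A" "(p, q) \<in> linked m V x"
proof -
  have "(u, v) \<in> (linked m V x)\<^sup>*" using assms by (auto simp: connected_by_def)
  then have "v \<notin> A \<longrightarrow> (\<exists>p q. p \<in> A \<and> q \<in> V - A \<and> (p, q) \<in> linked m V x)"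
  proof induction
    case base then show ?case using assms by simp
  next
    case (step v w)
    then show ?case by (cases "v \<in> A") (auto simp: linked_def)
  qed
  then show ?thesis using assms that by blast
qed

lemma component_member:
  assumes "r \<subseteq> V \<times> V" "sym r" "B \<in> components r V" "u \<in> B"
  shows "B = r\<^sup>* `` {u}"
proof -
  obtain w where w: "B = r\<^sup>* `` {w}" using assms by (auto simp: components_def)
  have "(w, u) \<in> r\<^sup>*" "(u, w) \<in> r\<^sup>*"
    using w assms sym_rtrancl[of r] by (auto dest: symD)
  then show ?thesis using w by (auto intro: rtrancl_trans)
qed

lemma partition_on_components:
  assumes "r \<subseteq> V \<times> V" "sym r"
  shows "partition_on V (components r V)"
proof (rule partition_onI)
  have "r\<^sup>* `` {u} \<subseteq> V" if "u \<in> V" for u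
    using that assms(1) by (auto elim: rtranclE)
  then show "\<Union> (components r V) = V" by (auto simp: components_def)
  show "disjnt B C" if "B \<in> components r V" "C \<in> components r V" "B \<noteq> C" for B C
    using component_member[OF assms that(1)] component_member[OF assms that(2)] that(3)
    by (auto simp: disjnt_def)
  show "{} \<notin> components r V" by (auto simp: components_def)
qed

text \<open>
  A path between two points of a component never leaves it, since all its vertices are reachable
  from its start. So a component is connected as a graph of its own.
\<close>

lemma component_connected:
  assumes "r \<subseteq> V \<times> V" "sym r" "B \<in> components r V" "u \<in> B" "v \<in> B"
  shows "(u, v) \<in> (r \<inter> B \<times> B)\<^sup>*"
proof -
  note B = component_member[OF assms(1-4)]
  have "(u, v) \<in> r\<^sup>*" using assms(5) B by auto
  then show ?thesis
  proof induction
    case base show ?case by simp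
  next
    case (step v w)
    then have "v \<in> B" "w \<in> B" using B by (auto intro: rtrancl_into_rtrancl)
    with step show ?case by (auto intro: rtrancl_into_rtrancl)
  qed
qed

lemma linked_subset: "linked m V x \<subseteq> V \<times> V"
  by (auto simp: linked_def)

text \<open>
  The relation \<open>r\<close> may be smaller than the full link relation: for a flat it consists of the
  links given by the hyperplanes of one chosen family.
\<close>

lemma connected_by_component:
  assumes "r \<subseteq> linked m V x" "sym r" "B \<in> components r V"
  shows "connected_by m B x"
proof -
  have r: "r \<subseteq> V \<times> V" using assms(1) linked_subset by blast
  have "r \<inter> B \<times> B \<subseteq> linked m B x" using assms(1) by (auto simp: linked_def)
  then have "(r \<inter> B \<times> B)\<^sup>* \<subseteq> (linked m B x)\<^sup>*" by (rule rtrancl_mono)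
  moreover have "B \<noteq> {}" using assms(3) by (auto simp: components_def)
  ultimately show ?thesis
    using component_connected[OF r assms(2,3)] unfolding connected_by_def by blast
qed

text \<open>
  A partition into connected blocks with no links between different blocks can only be the
  partition into components. This recovers the outermost list of blocks from a configuration.
\<close>

lemma components_eqI:
  assumes p: "partition_on V \<pi>" and c: "\<forall>B\<in>\<pi>. connected_by m B x"
    and sep: "\<And>B C u v. B \<in> \<pi> \<Longrightarrow> C \<in> \<pi> \<Longrightarrow> B \<noteq> C \<Longrightarrow> u \<in> B \<Longrightarrow> v \<in> C \<Longrightarrow> (u, v) \<notin> linked m V x"
  shows "\<pi> = components (linked m V x) V"
proof -
  let ?r = "linked m V x"
  have *: "B = ?r\<^sup>* `` {u}" if B: "B \<in> \<pi>" "u \<in> B" for B u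
  proof
    have "linked m B x \<subseteq> ?r"
      using partition_block[OF p B(1)] by (intro linked_mono) auto
    then have "(linked m B x)\<^sup>* \<subseteq> ?r\<^sup>*" by (rule rtrancl_mono)
    then show "B \<subseteq> ?r\<^sup>* `` {u}" using c B unfolding connected_by_def by auto
    have "v \<in> B" if "(u, v) \<in> ?r\<^sup>*" for v
      using that
    proof induction
      case base show ?case by (rule B)
    next
      case (step v w)
      then have "w \<in> \<Union>\<pi>" using p by (auto simp: linked_def partition_on_def)
      then show ?case using sep[OF B(1)] step by blast
    qed
    then show "?r\<^sup>* `` {u} \<subseteq> B" by auto
  qed
  have U: "\<Union>\<pi> = V" "{} \<notin> \<pi>" using p by (auto simp: partition_on_def)
  show ?thesis
  proof
    show "\<pi> \<subseteq> components ?r V"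
    proof
      fix B assume B: "B \<in> \<pi>"
      then obtain u where "u \<in> B" using U by (metis all_not_in_conv)
      then show "B \<in> components ?r V" using * B U unfolding components_def by blast
    qed
    show "components ?r V \<subseteq> \<pi>"
      unfolding components_def using * U by blast
  qed
qed

section \<open>Lists of abutting blocks\<close>

definition separated :: "nat \<Rightarrow> ('a \<Rightarrow> real) \<Rightarrow> 'a set \<Rightarrow> 'a set \<Rightarrow> bool" where
  "separated d x B C \<longleftrightarrow> (\<forall>u\<in>B. \<forall>v\<in>C. x u + real d \<le> x v)"

text \<open>
  The next block starts exactly at distance \<open>d\<close> after the end of the previous one. Stating this
  with an attained lower bound on differences avoids minima and maxima of blocks.
\<close>

definition abuts :: "nat \<Rightarrow> ('a \<Rightarrow> real) \<Rightarrow> 'a set \<Rightarrow> 'a set \<Rightarrow> bool" where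
  "abuts d x B C \<longleftrightarrow> separated d x B C \<and> (\<exists>u\<in>B. \<exists>v\<in>C. x v = x u + real d)"

lemma separated_trans:
  assumes "separated d x A B" "separated d x B C" "B \<noteq> {}"
  shows "separated d x A C"
proof -
  obtain b where "b \<in> B" using assms(3) by blast
  then show ?thesis using assms(1,2) unfolding separated_def by fastforce
qed

text \<open>
  Separation is transitive only through nonempty blocks, hence the hypothesis on the list.
\<close>

lemma sorted_separated:
  assumes "successively (abuts d x) f" "{} \<notin> set f"
  shows "sorted_wrt (separated d x) f"
proof -
  have "successively (separated d x) f"
    using assms(1) by (rule successively_mono) (auto simp: abuts_def)
  then show ?thesis
    using assms(2) successively_iff_sorted_wrt_strong[of f "separated d x"] separated_trans
    by metis
qed

lemma separated_pair:
  assumes "sorted_wrt P f" "B \<in> set f" "C \<in> set f" "B \<noteq> C"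
  shows "P B C \<or> P C B"
proof -
  from assms(1) have *: "\<forall>i<j. P (f ! i) (f ! j)" if "j < length f" for j
    using that by (auto simp: sorted_wrt_iff_nth_less)
  obtain i j where "f ! i = B" "f ! j = C" "i < length f" "j < length f"
    using assms(2,3) by (auto simp: in_set_conv_nth)
  then show ?thesis using * assms(4) by (metis nat_neq_iff)
qed

text \<open>
  Consecutive blocks are joined by the pair of particles at distance exactly \<open>d\<close>.
\<close>

lemma connected_by_blocks:
  assumes "successively (abuts d x) f" "f \<noteq> []" "\<forall>B\<in>set f. connected_by d B x"
  shows "connected_by d (\<Union>(set f)) x"
  using assms
proof (induction f)
  case (Cons B f)
  show ?case
  proof (cases f)
    case Nil then show ?thesis using Cons by simp
  next
    case (Cons C f')
    then have c: "connected_by d (\<Union>(set f)) x" "connected_by d B x"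
      using Cons.IH Cons.prems by auto
    obtain u v where uv: "u \<in> B" "v \<in> C" "x v = x u + real d"
      using Cons.prems Cons by (auto simp: abuts_def)
    then show ?thesis using connected_by_union[OF c(2,1), of u v] Cons by auto
  qed
qed simp

text \<open>
  If two configurations agree on each block up to a translation, the exact distance between
  consecutive blocks forces the translations to agree: a pair attaining distance \<open>d\<close> in \<open>x\<close> has
  distance at least \<open>d\<close> in \<open>y\<close>, which compares the two translations in one direction, and the
  roles of \<open>x\<close> and \<open>y\<close> can be exchanged.
\<close>

lemma abutting_blocks_unique:
  assumes "successively (abuts d x) f" "successively (abuts d y) f"
    and "\<forall>B\<in>set f. \<exists>t. \<forall>v\<in>B. y v = x v + t"
  shows "\<exists>t. \<forall>v\<in>\<Union>(set f). y v = x v + t"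
  using assms
proof (induction f)
  case (Cons B f)
  obtain s where s: "\<forall>v\<in>B. y v = x v + s" using Cons.prems by auto
  show ?case
  proof (cases f)
    case Nil then show ?thesis using s by (intro exI[of _ s]) simp
  next
    case (Cons C f')
    then obtain t where t: "\<forall>v\<in>\<Union>(set f). y v = x v + t"
      using Cons.IH Cons.prems by auto
    then have tC: "\<forall>v\<in>C. y v = x v + t" using Cons by auto
    have a: "abuts d x B C" "abuts d y B C" using Cons.prems Cons by auto
    have "s \<le> t" 
    proof -
      obtain u v where uv: "u \<in> B" "v \<in> C" "x v = x u + real d" using a by (auto simp: abuts_def)
      then have "y u + real d \<le> y v" using a by (auto simp: abuts_def separated_def)
      with uv s tC show ?thesis by simp
    qed
    moreover have "t \<le> s" 
    proof -
      obtain u v where uv: "u \<in> B" "v \<in> C" "y v = y u + real d" using a by (auto simp: abuts_def)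
      then have "x u + real d \<le> x v" using a by (auto simp: abuts_def separated_def)
      with uv s tC show ?thesis by simp
    qed
    ultimately have "s = t" by simp
    then show ?thesis using s t by (intro exI[of _ t]) auto
  qed
qed simp

lemma abuts_cong: "\<forall>v\<in>B\<union>C. y v = x v \<Longrightarrow> abuts d y B C = abuts d x B C"
  by (auto simp: abuts_def separated_def)

lemma successively_cong_set:
  assumes "\<And>B C. B \<in> set f \<Longrightarrow> C \<in> set f \<Longrightarrow> P B C = Q B C"
  shows "successively P f = successively Q f"
  using assms by (induction f) (auto simp: successively_Cons)

text \<open>
  The blocks are laid down from the right: the new first block is shifted so that its maximum
  lies at distance \<open>d\<close> before the minimum of the block after it.
\<close>

lemma abutting_blocks_exist:
  assumes "distinct f" "disjoint (set f)" "\<forall>B\<in>set f. finite B \<and> B \<noteq> {}"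
  shows "\<exists>x. successively (abuts d x) f \<and> (\<forall>B\<in>set f. \<exists>t. \<forall>v\<in>B. x v = Y B v + t)"
  using assms
proof (induction f)
  case (Cons B f)
  have dB: "B \<inter> C = {}" if "C \<in> set f" for C
    using Cons.prems that by (auto simp: disjoint_def)
  have "disjoint (set f)" using Cons.prems by (auto simp: disjoint_def)
  then obtain x where x: "successively (abuts d x) f" "\<forall>B\<in>set f. \<exists>t. \<forall>v\<in>B. x v = Y B v + t"
    using Cons by auto
  show ?case
  proof (cases f)
    case Nil
    then show ?thesis by (intro exI[of _ "Y B"]) (auto intro: exI[of _ 0])
  next
    case (Cons C f')
    define b c where "b = Max (Y B ` B)" and "c = Min (x ` C)"
    have BC: "finite B" "B \<noteq> {}" "finite C" "C \<noteq> {}" using Cons.prems Cons by auto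
    define y where "y = (\<lambda>v. if v \<in> B then Y B v + (c - b - real d) else x v)"
    have "b \<in> Y B ` B" "c \<in> x ` C" unfolding b_def c_def using BC by simp_all
    then obtain u v where uv: "u \<in> B" "Y B u = b" "v \<in> C" "x v = c" by auto
    have yx: "y w = x w" if "w \<in> D" "D \<in> set f" for w D
      using dB[OF that(2)] that(1) unfolding y_def by auto
    have yC: "y w = x w" if "w \<in> C" for w using yx[OF that] Cons by simp
    have "abuts d y B C"
      unfolding abuts_def separated_def
    proof (intro conjI ballI)
      fix p q assume pq: "p \<in> B" "q \<in> C"
      have "Y B p \<le> b" "c \<le> x q" unfolding b_def c_def using pq BC by auto
      then show "y p + real d \<le> y q" using pq yC[OF pq(2)] by (simp add: y_def)
    next
      show "\<exists>u\<in>B. \<exists>v\<in>C. y v = y u + real d"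
        by (rule bexI[OF _ uv(1)], rule bexI[OF _ uv(3)])
          (use uv yC[OF uv(3)] in \<open>simp add: y_def\<close>)
    qed
    moreover have "successively (abuts d y) f = successively (abuts d x) f"
      by (intro successively_cong_set abuts_cong) (auto simp: yx)
    ultimately have "successively (abuts d y) (B # f)" using x Cons by simp
    moreover have "\<exists>t. \<forall>v\<in>B. y v = Y B v + t"
      by (intro exI[of _ "c - b - real d"]) (auto simp: y_def)
    moreover have "\<exists>t. \<forall>v\<in>D. y v = Y D v + t" if "D \<in> set f" for D
      using x(2) that yx by auto
    ultimately show ?thesis by auto
  qed
qed simp

section \<open>Iterated lists as connected injective configurations\<close>

abbreviation nested_lists :: "nat \<Rightarrow> ('a, ('a, 'a set list) iterated) species" where
  "nested_lists m \<equiv> iterate (nonempty list_species) m"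

text \<open>
  The configurations described by an iterated list: at the outermost of \<open>m + 1\<close> levels, the
  blocks stand one after the other at distance \<open>m + 1\<close>, and inside each block the gaps are
  given by the lower levels, hence at most \<open>m\<close>. It is a relation rather than a function
  because a configuration is determined only up to translation.
\<close>

primrec placed :: "nat \<Rightarrow> ('a, 'a set list) iterated \<Rightarrow> ('a \<Rightarrow> real) \<Rightarrow> bool" where
  "placed 0 s x \<longleftrightarrow> True"
| "placed (Suc m) s x \<longleftrightarrow>
     (case the_level s of (\<pi>, f, g) \<Rightarrow>
        (\<forall>B\<in>\<pi>. placed m (g B) x) \<and> successively (abuts (Suc m) x) f)"

lemma nested_lists_0: "s \<in> struct (nested_lists 0) V \<longleftrightarrow> s = Base V \<and> card V = 1"
  by (auto simp: rename_def of_card_def set_species_def)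

lemma nonempty_list_mem:
  "f \<in> struct (nonempty list_species) V \<longleftrightarrow> f \<noteq> [] \<and> distinct f \<and> set f = V"
  by (auto simp: nonempty_def list_species_def)

lemma nested_lists_Suc:
  "s \<in> struct (nested_lists (Suc m)) V \<longleftrightarrow>
     (\<exists>f g. s = Level (set f, f, g) \<and> partition_on V (set f) \<and> f \<noteq> [] \<and> distinct f
        \<and> g \<in> (\<Pi>\<^sub>E B\<in>set f. struct (nested_lists m) B))"
proof -
  have "s \<in> struct (nested_lists (Suc m)) V \<longleftrightarrow>
    (\<exists>\<pi> f g. s = Level (\<pi>, f, g) \<and> (\<pi>, f, g) \<in> struct (nonempty list_species \<circ>\<^sub>S nested_lists m) V)"
    by (auto simp only: iterate.simps rename_def species.simps image_iff split_paired_Ex Bex_def)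
  then show ?thesis unfolding subst_mem nonempty_list_mem by blast
qed

lemma nested_lists_SucE:
  assumes "s \<in> struct (nested_lists (Suc m)) V"
  obtains f g where "s = Level (set f, f, g)" "partition_on V (set f)" "f \<noteq> []" "distinct f"
    "g \<in> (\<Pi>\<^sub>E B\<in>set f. struct (nested_lists m) B)"
  using assms unfolding nested_lists_Suc by blast

lemma placed_Level:
  "placed (Suc m) (Level (\<pi>, f, g)) x \<longleftrightarrow>
     (\<forall>B\<in>\<pi>. placed m (g B) x) \<and> successively (abuts (Suc m) x) f"
  by simp

declare iterate.simps [simp del] placed.simps(2) [simp del]

text \<open>
  The case \<open>t = 0\<close> says that only the coordinates indexed by \<open>V\<close> matter.
\<close>

lemma placed_translate:
  assumes "s \<in> struct (nested_lists m) V" "placed m s x" "\<forall>v\<in>V. y v = x v + t"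
  shows "placed m s y"
  using assms
proof (induction m arbitrary: V s)
  case (Suc m)
  obtain f g where s: "s = Level (set f, f, g)" "partition_on V (set f)"
    "g \<in> (\<Pi>\<^sub>E B\<in>set f. struct (nested_lists m) B)"
    using Suc.prems(1) by (rule nested_lists_SucE)
  have V: "B \<subseteq> V" if "B \<in> set f" for B using partition_block[OF s(2) that] .
  have "placed m (g B) y" if B: "B \<in> set f" for B
    using Suc.IH[of "g B" B] s B V[OF B] Suc.prems(2,3) by (auto simp: placed_Level)
  moreover have "abuts (Suc m) y B C = abuts (Suc m) x B C" if "B \<in> set f" "C \<in> set f" for B C
  proof -
    have "y v = x v + t" if "v \<in> B \<or> v \<in> C" for v
      using Suc.prems(3) V \<open>B \<in> set f\<close> \<open>C \<in> set f\<close> that by blast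
    then show ?thesis by (auto simp: abuts_def separated_def)
  qed
  then have "successively (abuts (Suc m) y) f = successively (abuts (Suc m) x) f"
    by (rule successively_cong_set)
  ultimately show ?case using Suc.prems(2) s by (auto simp: placed_Level)
qed simp

lemma placed_exists:
  assumes "finite V" "s \<in> struct (nested_lists m) V"
  shows "\<exists>x. placed m s x"
  using assms
proof (induction m arbitrary: V s)
  case (Suc m)
  obtain f g where s: "s = Level (set f, f, g)" "partition_on V (set f)" "distinct f"
    "g \<in> (\<Pi>\<^sub>E B\<in>set f. struct (nested_lists m) B)"
    using Suc.prems(2) by (rule nested_lists_SucE)
  have fin: "finite B" if "B \<in> set f" for B
    using partition_block[OF s(2) that] Suc.prems(1) by (rule finite_subset)
  have gB: "g B \<in> struct (nested_lists m) B" if "B \<in> set f" for B using s(4) that by auto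
  have "\<forall>B\<in>set f. \<exists>x. placed m (g B) x" using Suc.IH fin gB by blast
  then obtain Y where Y: "\<forall>B\<in>set f. placed m (g B) (Y B)" by metis
  obtain x where x: "successively (abuts (Suc m) x) f"
    "\<forall>B\<in>set f. \<exists>t. \<forall>v\<in>B. x v = Y B v + t"
    using abutting_blocks_exist[of f "Suc m" Y] s fin by (auto simp: partition_on_def)
  have "placed m (g B) x" if "B \<in> set f" for B
    using x(2) Y that placed_translate[OF gB[OF that]] by blast
  then show ?case using x(1) s(1) by (auto simp: placed_Level)
qed auto

lemma placed_unique:
  assumes "s \<in> struct (nested_lists m) V" "placed m s x" "placed m s y"
  shows "\<exists>t. \<forall>v\<in>V. y v = x v + t"
  using assms
proof (induction m arbitrary: V s)
  case 0
  then obtain v where "V = {v}" by (auto simp: nested_lists_0 card_1_singleton_iff)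
  then show ?case by (intro exI[of _ "y v - x v"]) simp
next
  case (Suc m)
  obtain f g where s: "s = Level (set f, f, g)" "partition_on V (set f)"
    "g \<in> (\<Pi>\<^sub>E B\<in>set f. struct (nested_lists m) B)"
    using Suc.prems(1) by (rule nested_lists_SucE)
  have "\<forall>B\<in>set f. \<exists>t. \<forall>v\<in>B. y v = x v + t"
  proof
    fix B assume "B \<in> set f"
    then show "\<exists>t. \<forall>v\<in>B. y v = x v + t"
      using Suc.IH[of "g B" B] s Suc.prems(2,3) by (auto simp: placed_Level)
  qed
  moreover have "\<Union>(set f) = V" using s(2) by (simp add: partition_on_def)
  ultimately show ?case
    using abutting_blocks_unique[of "Suc m" x f y] Suc.prems(2,3) s(1) by (auto simp: placed_Level)
qed

lemma placed_connected:
  assumes "s \<in> struct (nested_lists m) V" "placed m s x"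
  shows "connected_by m V x \<and> inj_on x V"
  using assms
proof (induction m arbitrary: V s)
  case 0
  then obtain v where "V = {v}" by (auto simp: nested_lists_0 card_1_singleton_iff)
  then show ?case by (simp add: connected_by_def)
next
  case (Suc m)
  obtain f g where s: "s = Level (set f, f, g)" "partition_on V (set f)" "f \<noteq> []"
    "g \<in> (\<Pi>\<^sub>E B\<in>set f. struct (nested_lists m) B)"
    using Suc.prems(1) by (rule nested_lists_SucE)
  have U: "\<Union>(set f) = V" "{} \<notin> set f" using s(2) by (auto simp: partition_on_def)
  have a: "successively (abuts (Suc m) x) f" using Suc.prems(2) s(1) by (simp add: placed_Level)
  have *: "connected_by m B x \<and> inj_on x B" if "B \<in> set f" for B
    using Suc.IH[of "g B" B] s Suc.prems(2) that by (auto simp: placed_Level)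
  have "connected_by (Suc m) B x" if "B \<in> set f" for B
    using *[OF that] connected_by_mono[of m B x "Suc m"] by simp
  then have "connected_by (Suc m) V x"
    using connected_by_blocks[OF a s(3)] U(1) by simp
  moreover have "inj_on x V"
  proof (rule inj_onI)
    fix u v assume "u \<in> V" "v \<in> V" and eq: "x u = x v"
    then obtain B C where BC: "B \<in> set f" "u \<in> B" "C \<in> set f" "v \<in> C" using U by blast
    have "B = C"
    proof (rule ccontr)
      assume "B \<noteq> C"
      then have "separated (Suc m) x B C \<or> separated (Suc m) x C B"
        using separated_pair[OF sorted_separated[OF a U(2)] BC(1,3)] by simp
      then show False using BC eq by (fastforce simp: separated_def)
    qed
    then show "u = v" using *[OF BC(1)] BC eq by (auto dest: inj_onD)
  qed
  ultimately show ?case ..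
qed

text \<open>
  This is the naturality of the correspondence between iterated lists and configurations.
\<close>

lemma placed_transport:
  assumes "s \<in> struct (nested_lists m) V" "inj_on \<sigma> V"
  shows "placed m (transport (nested_lists m) V \<sigma> s) x \<longleftrightarrow> placed m s (x \<circ> \<sigma>)"
  using assms
proof (induction m arbitrary: V s)
  case (Suc m)
  obtain f g where s: "s = Level (set f, f, g)" "partition_on V (set f)"
    "g \<in> (\<Pi>\<^sub>E B\<in>set f. struct (nested_lists m) B)"
    using Suc.prems(1) by (rule nested_lists_SucE)
  obtain h where h: "transport (nonempty list_species \<circ>\<^sub>S nested_lists m) V \<sigma> (set f, f, g) =
      ((`) \<sigma> ` set f, transport (nonempty list_species) (set f) ((`) \<sigma>) f, h)"
    "\<And>B. B \<in> set f \<Longrightarrow> h (\<sigma> ` B) = transport (nested_lists m) B \<sigma> (g B)"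
    using subst_transport[OF Suc.prems(2) s(2), of "nonempty list_species" "nested_lists m" f g]
    by metis
  have t: "transport (nested_lists (Suc m)) V \<sigma> s = Level ((`) \<sigma> ` set f, map ((`) \<sigma>) f, h)"
    using h(1) by (simp add: iterate.simps rename_def s(1) nonempty_def list_species_def)
  have "placed m (h (\<sigma> ` B)) x \<longleftrightarrow> placed m (g B) (x \<circ> \<sigma>)" if B: "B \<in> set f" for B
  proof -
    have "inj_on \<sigma> B" using Suc.prems(2) partition_block[OF s(2) B] by (rule inj_on_subset)
    then show ?thesis unfolding h(2)[OF B] using s(3) B by (intro Suc.IH) auto
  qed
  moreover have "abuts (Suc m) x (\<sigma> ` B) (\<sigma> ` C) = abuts (Suc m) (x \<circ> \<sigma>) B C" for B C
    by (simp add: abuts_def separated_def)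
  ultimately show ?case
    unfolding t unfolding s(1) placed_Level successively_map by (simp add: comp_def)
qed simp

text \<open>
  Separated blocks are disjoint and ordered, so any particle can represent its block for the purpose
  of sorting.
\<close>

definition position :: "('a \<Rightarrow> real) \<Rightarrow> 'a set \<Rightarrow> real" where
  "position x B = x (SOME v. v \<in> B)"

lemma separated_position:
  assumes "separated (Suc m) x B C" "B \<noteq> {}" "C \<noteq> {}"
  shows "position x B < position x C"
proof -
  have "(SOME v. v \<in> B) \<in> B" "(SOME v. v \<in> C) \<in> C" using assms(2,3) by (simp_all add: some_in_eq)
  then show ?thesis using assms(1) unfolding separated_def position_def by fastforce
qed

lemma separated_list_unique:
  assumes f: "sorted_wrt (separated (Suc m) x) f" and g: "sorted_wrt (separated (Suc m) x) g"
    and eq: "set f = set g" and ne: "{} \<notin> set f"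
  shows "f = g"
proof -
  have s: "sorted_wrt (<) (map (position x) h)" if "sorted_wrt (separated (Suc m) x) h" "{} \<notin> set h" for h
    unfolding sorted_wrt_map using that(1)
    by (rule sorted_wrt_mono_rel[rotated]) (use that(2) separated_position in metis)
  have "map (position x) f = map (position x) g"
    using s[OF f ne] s[OF g] ne eq by (intro strict_sorted_equal) auto
  moreover have "inj_on (position x) (set f)"
  proof (rule inj_onI, rule ccontr)
    fix B C assume BC: "B \<in> set f" "C \<in> set f" "position x B = position x C" "B \<noteq> C"
    then show False
      using separated_pair[OF f BC(1,2,4)] separated_position ne by (metis less_irrefl)
  qed
  ultimately show ?thesis using eq inj_on_map_eq_map[of "position x" f g] by simp
qed

lemma separated_list_exists:
  assumes fin: "finite \<pi>" and ne: "{} \<notin> \<pi>"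
    and tot: "\<And>B C. B \<in> \<pi> \<Longrightarrow> C \<in> \<pi> \<Longrightarrow> B \<noteq> C \<Longrightarrow> separated (Suc m) x B C \<or> separated (Suc m) x C B"
  obtains f where "set f = \<pi>" "distinct f" "sorted_wrt (separated (Suc m) x) f"
proof
  let ?p = "position x"
  have inj: "inj_on ?p \<pi>"
  proof (rule inj_onI, rule ccontr)
    fix B C assume BC: "B \<in> \<pi>" "C \<in> \<pi>" "?p B = ?p C" "B \<noteq> C"
    then have "B \<noteq> {}" "C \<noteq> {}" using ne by auto
    then show False
      using tot[OF BC(1,2,4)] separated_position[of m x B C] separated_position[of m x C B] BC(3)
      by auto
  qed
  define f where "f = map (inv_into \<pi> ?p) (sorted_list_of_set (?p ` \<pi>))"
  show f: "set f = \<pi>" using fin inj by (simp add: f_def image_image)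
  have p: "map ?p f = sorted_list_of_set (?p ` \<pi>)"
    unfolding f_def map_map by (rule map_idI) (use fin in \<open>auto simp: f_inv_into_f\<close>)
  have "distinct (map ?p f)" unfolding p by simp
  then show "distinct f" by (simp add: distinct_map)
  have "sorted_wrt (<) (map ?p f)"
    unfolding p by (rule strict_sorted_list_of_set)
  then have "sorted_wrt (\<lambda>B C. ?p B < ?p C) f" unfolding sorted_wrt_map .
  then show "sorted_wrt (separated (Suc m) x) f"
  proof (rule sorted_wrt_mono_rel[rotated])
    fix B C assume BC: "B \<in> set f" "C \<in> set f" "?p B < ?p C"
    have B: "B \<in> \<pi>" "C \<in> \<pi>" using BC(1,2) unfolding f .
    have ne': "B \<noteq> {}" "C \<noteq> {}" "B \<noteq> C" using B ne BC(3) by (metis, metis, metis less_irrefl)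
    have "\<not> separated (Suc m) x C B"
      using separated_position[OF _ ne'(2,1)] BC(3) by fastforce
    then show "separated (Suc m) x B C" using tot[OF B ne'(3)] by blast
  qed
qed

text \<open>
  Let \<open>B\<close> and \<open>C\<close> be components for links of length at most \<open>m\<close>, in a configuration whose
  differences are all integers. A particle of \<open>B\<close> and one of \<open>C\<close> then differ by at least
  \<open>m + 1\<close>. A step along a link moves by at most \<open>m\<close>, so walking inside \<open>B\<close> never jumps over a
  particle of \<open>C\<close>, and walking inside \<open>C\<close> never jumps over a particle of \<open>B\<close>. The order of
  one pair therefore decides the order of all pairs.
\<close>

lemma components_separated:
  assumes c: "connected_by n V x" and B: "B \<in> components (linked m V x) V"
    and C: "C \<in> components (linked m V x) V" and ne: "B \<noteq> C"
    and uv: "u \<in> B" "v \<in> C" "x u < x v"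
  shows "separated (Suc m) x B C"
proof -
  let ?r = "linked m V x"
  note comp = component_member[OF linked_subset linked_sym]
  have sub: "D \<subseteq> V" if "D \<in> components ?r V" for D
    using partition_block[OF partition_on_components[OF linked_subset linked_sym] that] .
  have far: "real (Suc m) \<le> \<bar>x p - x q\<bar>"
    if pq: "p \<in> D" "q \<in> V" "q \<notin> D" and D: "D \<in> components ?r V" for p q D
  proof -
    have pV: "p \<in> V" using sub[OF D] pq by blast
    obtain a :: int where a: "x p - x q = of_int a"
      using connected_by_diff_int[OF c pV pq(2)] .
    have "(p, q) \<notin> ?r" using pq comp[OF D pq(1)] by auto
    then have "int (Suc m) \<le> \<bar>a\<bar>" using a pV pq(2) by (auto simp: linked_def)
    then show ?thesis unfolding a by linarith
  qed
  have near: "x q \<le> x p + real m" "x p \<le> x q + real m" if "(p, q) \<in> ?r" for p q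
    using that by (auto simp: linked_def)
  have disj: "B \<inter> C = {}"
    using comp[OF B] comp[OF C] ne by blast
  have below: "x p < x v" if "p \<in> B" for p
  proof -
    have "(u, p) \<in> ?r\<^sup>*" using comp[OF B uv(1)] that by auto
    then show ?thesis
    proof induction
      case base show ?case by (rule uv)
    next
      case (step p q)
      have "p \<in> B" using comp[OF B uv(1)] step by auto
      then have "x p + real (Suc m) \<le> x v"
        using far[of p B v] step uv disj sub[OF C] B by fastforce
      then show ?case using near(1)[OF step(2)] by simp
    qed
  qed
  have above: "x p < x q" if "p \<in> B" "q \<in> C" for p q
  proof -
    have "(v, q) \<in> ?r\<^sup>*" using comp[OF C uv(2)] that by auto
    then show ?thesis
    proof induction
      case base show ?case using below that by simp
    next
      case (step w q)
      have "w \<in> C" using comp[OF C uv(2)] step by auto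
      then have "x p + real (Suc m) \<le> x w"
        using far[of w C p] step that disj sub[OF B] C by fastforce
      then show ?case using near(2)[OF step(2)] by simp
    qed
  qed
  show ?thesis
    unfolding separated_def
  proof (intro ballI)
    fix p q assume pq: "p \<in> B" "q \<in> C"
    then show "x p + real (Suc m) \<le> x q"
      using far[of p B q] above[of p q] disj sub[OF C] B by fastforce
  qed
qed

text \<open>
  Connectedness gives a link of length at most \<open>m + 1\<close> across each cut between consecutive
  blocks. Its length is exactly \<open>m + 1\<close>, and it joins the two blocks next to the cut: a link
  between blocks further apart would pass over a whole block and have length at least twice
  \<open>m + 1\<close>. The prefix \<open>ps\<close> of blocks already treated carries the induction.
\<close>

lemma separated_connected_abuts:
  assumes "sorted_wrt (separated (Suc m) x) (ps @ f)" "{} \<notin> set f"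
    and "connected_by (Suc m) (\<Union>(set (ps @ f))) x"
  shows "successively (abuts (Suc m) x) f"
  using assms
proof (induction f arbitrary: ps)
  case (Cons B f)
  have IH: "successively (abuts (Suc m) x) f"
    using Cons.IH[of "ps @ [B]"] Cons.prems by simp
  show ?case
  proof (cases f)
    case Nil then show ?thesis by simp
  next
    case (Cons C f')
    let ?d = "Suc m" and ?A = "\<Union>(set (ps @ [B]))" and ?V = "\<Union>(set (ps @ B # f))"
    have sep: "separated ?d x D E" if "D \<in> set ps \<union> {B}" "E \<in> set f" for D E
      using Cons.prems(1) that by (auto simp: sorted_wrt_append)
    have sepB: "separated ?d x D B" if "D \<in> set ps" for D
      using Cons.prems(1) that by (auto simp: sorted_wrt_append)
    have sepC: "separated ?d x C E" if "E \<in> set f'" for E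
      using Cons.prems(1) that Cons by (auto simp: sorted_wrt_append)
    obtain b c where bc: "b \<in> B" "c \<in> C" using Cons.prems(2) Cons by auto
    have "c \<notin> ?A"
    proof
      assume "c \<in> ?A"
      then obtain D where "D \<in> set ps \<union> {B}" "c \<in> D" by auto
      then have "x c + real ?d \<le> x c"
        using sep[of D C] bc(2) Cons unfolding separated_def by (meson list.set_intros(1))
      then show False by simp
    qed
    then obtain p q where pq: "p \<in> ?A" "q \<in> ?V - ?A" "(p, q) \<in> linked ?d ?V x"
      using connected_by_cut[OF Cons.prems(3), of ?A b c] bc Cons by auto
    obtain D E where DE: "D \<in> set ps \<union> {B}" "p \<in> D" "E \<in> set f" "q \<in> E" using pq by auto
    have le: "x q \<le> x p + real ?d" using pq(3) by (auto simp: linked_def)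
    have ge: "x p + real ?d \<le> x q" using sep[OF DE(1,3)] DE by (auto simp: separated_def)
    have "D = B"
    proof (rule ccontr)
      assume "D \<noteq> B"
      then have "x p + real ?d \<le> x b" using sepB[of D] DE bc by (auto simp: separated_def)
      moreover have "x b + real ?d \<le> x q" using sep[of B E] DE bc by (auto simp: separated_def)
      ultimately show False using le by simp
    qed
    moreover have "E = C"
    proof (rule ccontr)
      assume "E \<noteq> C"
      then have "x c + real ?d \<le> x q" using sepC[of E] DE bc Cons by (auto simp: separated_def)
      moreover have "x p + real ?d \<le> x c" using sep[of D C] DE bc Cons by (auto simp: separated_def)
      ultimately show False using le by simp
    qed
    ultimately have "abuts ?d x B C"
      unfolding abuts_def using sep[of B C] DE le ge Cons by force
    then show ?thesis using IH Cons by simp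
  qed
qed simp

text \<open>
  The blocks of the outermost list are forced to be the components for links of length at most
  \<open>m\<close>, their order is the order on the line, and the lower levels are given by induction. At
  level \<open>0\<close>, particles can be linked only at distance \<open>0\<close>, so that an injective connected
  configuration has a single particle.
\<close>

lemma placed_ex1:
  assumes "finite V" "connected_by m V x" "inj_on x V"
  shows "\<exists>!s. s \<in> struct (nested_lists m) V \<and> placed m s x"
  using assms
proof (induction m arbitrary: V)
  case 0
  obtain u where u: "u \<in> V" using 0 by (auto simp: connected_by_def)
  have "v = u" if "v \<in> V" for v
  proof -
    have "(u, v) \<in> (linked 0 V x)\<^sup>*" using 0 u that by (auto simp: connected_by_def)
    then show ?thesis
    proof induction
      case (step v w)
      then have "x v = x w" "v \<in> V" "w \<in> V" by (auto simp: linked_def)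
      with 0(3) have "v = w" by (rule inj_onD)
      with step(3) show ?case by simp
    qed simp
  qed
  with u have "V = {u}" by blast
  then show ?case by (simp add: nested_lists_0)
next
  case (Suc m)
  let ?r = "linked m V x"
  define \<pi> where "\<pi> = components ?r V"
  have p: "partition_on V \<pi>"
    unfolding \<pi>_def by (intro partition_on_components linked_subset linked_sym)
  then have ne: "{} \<notin> \<pi>" "\<Union>\<pi> = V" by (auto simp: partition_on_def)
  have ex1: "\<exists>!s. s \<in> struct (nested_lists m) B \<and> placed m s x" if B: "B \<in> \<pi>" for B
  proof (rule Suc.IH)
    have BV: "B \<subseteq> V" using p B by (rule partition_block)
    then show "finite B" "inj_on x B" using Suc.prems by (auto intro: finite_subset inj_on_subset)
    show "connected_by m B x"
      using B unfolding \<pi>_def by (intro connected_by_component[OF order_refl linked_sym])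
  qed
  have tot: "separated (Suc m) x B C \<or> separated (Suc m) x C B"
    if BC: "B \<in> \<pi>" "C \<in> \<pi>" "B \<noteq> C" for B C
  proof -
    obtain u v where uv: "u \<in> B" "v \<in> C" using BC ne by (metis all_not_in_conv)
    have "u \<noteq> v" using uv BC p by (auto simp: partition_on_def disjoint_def)
    moreover have "u \<in> V" "v \<in> V" using uv BC ne(2) by auto
    ultimately have "x u < x v \<or> x v < x u" using Suc.prems(3) by (metis inj_onD linorder_cases)
    then show ?thesis
      using components_separated[OF Suc.prems(2), of B m C u v]
        components_separated[OF Suc.prems(2), of C m B v u] uv BC unfolding \<pi>_def by blast
  qed
  obtain f where f: "set f = \<pi>" "distinct f" "sorted_wrt (separated (Suc m) x) f"
    using separated_list_exists[OF finite_elements[OF Suc.prems(1) p] ne(1) tot] by blast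
  have succ: "successively (abuts (Suc m) x) f"
    using separated_connected_abuts[of m x "[]" f] f ne Suc.prems(2) by simp
  have fne: "f \<noteq> []" using f(1) ne(2) Suc.prems(2) by (auto simp: connected_by_def)
  define g where "g = (\<lambda>B\<in>\<pi>. THE s. s \<in> struct (nested_lists m) B \<and> placed m s x)"
  have g: "g B \<in> struct (nested_lists m) B \<and> placed m (g B) x" if "B \<in> \<pi>" for B
    using theI'[OF ex1[OF that]] that by (simp add: g_def)
  show ?case
  proof (rule ex1I[of _ "Level (\<pi>, f, g)"])
    show "Level (\<pi>, f, g) \<in> struct (nested_lists (Suc m)) V \<and> placed (Suc m) (Level (\<pi>, f, g)) x"
      unfolding nested_lists_Suc placed_Level using p f fne g succ by (auto simp: g_def)
    fix s assume "s \<in> struct (nested_lists (Suc m)) V \<and> placed (Suc m) s x"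
    then have s: "s \<in> struct (nested_lists (Suc m)) V" "placed (Suc m) s x" by auto
    obtain f' g' where s': "s = Level (set f', f', g')" "partition_on V (set f')"
      "g' \<in> (\<Pi>\<^sub>E B\<in>set f'. struct (nested_lists m) B)"
      using s(1) by (rule nested_lists_SucE)
    have pl: "\<And>B. B \<in> set f' \<Longrightarrow> placed m (g' B) x" "successively (abuts (Suc m) x) f'"
      using s(2) s'(1) by (auto simp: placed_Level)
    have ne': "{} \<notin> set f'" using s'(2) by (auto simp: partition_on_def)
    have sep: "sorted_wrt (separated (Suc m) x) f'" by (rule sorted_separated[OF pl(2) ne'])
    have "set f' = \<pi>"
      unfolding \<pi>_def
    proof (rule components_eqI[OF s'(2)])
      show "\<forall>B\<in>set f'. connected_by m B x"
        using placed_connected[of "g' _" m] s'(3) pl(1) by blast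
      fix B C u v assume "B \<in> set f'" "C \<in> set f'" "B \<noteq> C" "u \<in> B" "v \<in> C"
      then show "(u, v) \<notin> linked m V x"
        using separated_pair[OF sep, of B C] by (fastforce simp: separated_def linked_def)
    qed
    moreover have "f' = f"
      using separated_list_unique[OF sep f(3)] calculation f(1) ne' by simp
    moreover have "g' = g"
    proof (rule extensionalityI[of _ \<pi>])
      show "g' \<in> extensional \<pi>" "g \<in> extensional \<pi>"
        using s'(3) calculation(1) by (auto simp: g_def PiE_def)
      fix B assume B: "B \<in> \<pi>"
      then have "g' B \<in> struct (nested_lists m) B \<and> placed m (g' B) x"
        using s'(3) pl(1) calculation(1) by auto
      then show "g' B = g B" using ex1[OF B] g[OF B] by blast
    qed
    ultimately show "s = Level (\<pi>, f, g)" using s'(1) by simp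
  qed
qed

section \<open>Connected configurations with coinciding particles\<close>

abbreviation blocked_lists ::
  "nat \<Rightarrow> ('a, 'a set set \<times> ('a set, 'a set set list) iterated \<times> ('a set \<Rightarrow> 'a set)) species" where
  "blocked_lists m \<equiv> nested_lists m \<circ>\<^sub>S nonempty set_species"

text \<open>
  The sets of the inner partition are the groups of coinciding particles; one particle per group
  gives an injective configuration, which is described by the iterated list.
\<close>

definition fits ::
  "nat \<Rightarrow> 'a set set \<times> ('a set, 'a set set list) iterated \<times> ('a set \<Rightarrow> 'a set) \<Rightarrow> ('a \<Rightarrow> real) \<Rightarrow> bool"
  where "fits m = (\<lambda>(\<rho>, h, e) x. \<exists>y. placed m h y \<and> (\<forall>C\<in>\<rho>. \<forall>v\<in>C. x v = y C))"

lemma blocked_lists_mem: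
  "q \<in> struct (blocked_lists m) V \<longleftrightarrow>
     (\<exists>\<rho> h. q = (\<rho>, h, \<lambda>C\<in>\<rho>. C) \<and> partition_on V \<rho> \<and> h \<in> struct (nested_lists m) \<rho>)"
proof -
  have *: "(\<Pi>\<^sub>E C\<in>\<rho>. struct (nonempty set_species) C) = {\<lambda>C\<in>\<rho>. C}"
    if "partition_on V \<rho>" for \<rho> :: "'a set set"
  proof -
    have "(\<Pi>\<^sub>E C\<in>\<rho>. struct (nonempty set_species) C) = (\<Pi>\<^sub>E C\<in>\<rho>. {C})"
      using partition_onD3[OF that]
      by (intro PiE_cong) (auto simp: nonempty_def set_species_def)
    also have "\<dots> = {\<lambda>C\<in>\<rho>. C}" 
      by (auto simp: PiE_iff intro!: extensionalityI[of _ \<rho>])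
    finally show ?thesis .
  qed
  obtain \<rho> h e where q: "q = (\<rho>, h, e)" by (cases q)
  show ?thesis by (cases "partition_on V \<rho>") (simp_all add: q subst_mem * conj_commute)
qed

lemma blocked_listsE:
  assumes "q \<in> struct (blocked_lists m) V"
  obtains \<rho> h where "q = (\<rho>, h, \<lambda>C\<in>\<rho>. C)" "partition_on V \<rho>" "h \<in> struct (nested_lists m) \<rho>"
  using assms unfolding blocked_lists_mem by blast

lemma fits_iff: "fits m (\<rho>, h, e) x \<longleftrightarrow> (\<exists>y. placed m h y \<and> (\<forall>C\<in>\<rho>. \<forall>v\<in>C. x v = y C))"
  by (simp add: fits_def)

lemma extend_over_blocks:
  assumes "partition_on V \<pi>"
  obtains x where "\<And>B v. B \<in> \<pi> \<Longrightarrow> v \<in> B \<Longrightarrow> x v = y B v"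
proof
  fix B v assume B: "B \<in> \<pi>" "v \<in> B"
  have "(THE C. C \<in> \<pi> \<and> v \<in> C) = B"
    using B assms by (intro the_equality) (auto simp: partition_on_def disjoint_def)
  then show "(\<lambda>v. y (THE C. C \<in> \<pi> \<and> v \<in> C) v) v = y B v" by simp
qed

lemma fits_exists:
  assumes "finite V" "q \<in> struct (blocked_lists m) V"
  shows "\<exists>x. fits m q x"
proof -
  obtain \<rho> h where q: "q = (\<rho>, h, \<lambda>C\<in>\<rho>. C)" "partition_on V \<rho>" "h \<in> struct (nested_lists m) \<rho>"
    using assms(2) by (rule blocked_listsE)
  obtain y where y: "placed m h y"
    using placed_exists[OF finite_elements[OF assms(1) q(2)] q(3)] by blast
  obtain x where "\<And>C v. C \<in> \<rho> \<Longrightarrow> v \<in> C \<Longrightarrow> x v = y C"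
    using extend_over_blocks[OF q(2), of "\<lambda>C v. y C"] by blast
  then show ?thesis using y unfolding q(1) fits_iff by blast
qed

lemma fits_translate:
  assumes "q \<in> struct (blocked_lists m) V" "fits m q x" "\<forall>v\<in>V. y v = x v + t"
  shows "fits m q y"
proof -
  obtain \<rho> h where q: "q = (\<rho>, h, \<lambda>C\<in>\<rho>. C)" "partition_on V \<rho>" "h \<in> struct (nested_lists m) \<rho>"
    using assms(1) by (rule blocked_listsE)
  obtain z where z: "placed m h z" "\<forall>C\<in>\<rho>. \<forall>v\<in>C. x v = z C"
    using assms(2) unfolding q(1) fits_iff by blast
  have "placed m h (\<lambda>C. z C + t)" using placed_translate[OF q(3) z(1), of "\<lambda>C. z C + t" t] by simp
  moreover have "\<forall>C\<in>\<rho>. \<forall>v\<in>C. y v = z C + t"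
    using z(2) assms(3) partition_block[OF q(2)] by fastforce
  ultimately show ?thesis unfolding q(1) fits_iff by blast
qed

lemma fits_unique:
  assumes "q \<in> struct (blocked_lists m) V" "fits m q x" "fits m q y"
  shows "\<exists>t. \<forall>v\<in>V. y v = x v + t"
proof -
  obtain \<rho> h where q: "q = (\<rho>, h, \<lambda>C\<in>\<rho>. C)" "partition_on V \<rho>" "h \<in> struct (nested_lists m) \<rho>"
    using assms(1) by (rule blocked_listsE)
  obtain z w where z: "placed m h z" "\<forall>C\<in>\<rho>. \<forall>v\<in>C. x v = z C"
    and w: "placed m h w" "\<forall>C\<in>\<rho>. \<forall>v\<in>C. y v = w C"
    using assms(2,3) unfolding q(1) fits_iff by blast
  obtain t where "\<forall>C\<in>\<rho>. w C = z C + t" using placed_unique[OF q(3) z(1) w(1)] ..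
  then have "\<forall>C\<in>\<rho>. \<forall>v\<in>C. y v = x v + t" using z(2) w(2) by simp
  then show ?thesis using q(2) by (auto simp: partition_on_def)
qed

text \<open>
  Coinciding particles are linked at distance \<open>0\<close>, and links between groups lift to links
  between any of their members.
\<close>

lemma fits_connected:
  assumes "q \<in> struct (blocked_lists m) V" "fits m q x"
  shows "connected_by m V x"
proof -
  obtain \<rho> h where q: "q = (\<rho>, h, \<lambda>C\<in>\<rho>. C)" "partition_on V \<rho>" "h \<in> struct (nested_lists m) \<rho>"
    using assms(1) by (rule blocked_listsE)
  obtain y where y: "placed m h y" "\<forall>C\<in>\<rho>. \<forall>v\<in>C. x v = y C"
    using assms(2) unfolding q(1) fits_iff by blast
  have c: "connected_by m \<rho> y" using placed_connected[OF q(3) y(1)] ..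
  have U: "\<Union>\<rho> = V" "{} \<notin> \<rho>" using q(2) by (auto simp: partition_on_def)
  let ?r = "linked m V x"
  have level: "(u, v) \<in> ?r" if "C \<in> \<rho>" "u \<in> C" "v \<in> C" for C u v
    using that y(2) U unfolding linked_def by (auto intro!: exI[of _ 0])
  have path: "\<forall>v\<in>D. (u, v) \<in> ?r\<^sup>*" if "(C, D) \<in> (linked m \<rho> y)\<^sup>*" "C \<in> \<rho>" "u \<in> C" for C D u
    using that(1)
  proof induction
    case base then show ?case using level that by blast
  next
    case (step D E)
    then have DE: "D \<in> \<rho>" "E \<in> \<rho>" by (auto simp: linked_def)
    then obtain w where w: "w \<in> D" using U by (metis all_not_in_conv)
    have "(w, v) \<in> ?r" if "v \<in> E" for v
    proof -
      have "x w = y D" "x v = y E" "w \<in> V" "v \<in> V" using y(2) w that DE U by auto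
      then show ?thesis using step(2) by (simp add: linked_def)
    qed
    then show ?case using step(3) w by (meson rtrancl_into_rtrancl)
  qed
  have "(u, v) \<in> ?r\<^sup>*" if uv: "u \<in> V" "v \<in> V" for u v
  proof -
    obtain C D where CD: "C \<in> \<rho>" "u \<in> C" "D \<in> \<rho>" "v \<in> D" using uv U by blast
    then have "(C, D) \<in> (linked m \<rho> y)\<^sup>*" using c by (auto simp: connected_by_def)
    from path[OF this CD(1,2)] CD(4) show ?thesis by blast
  qed
  moreover have "V \<noteq> {}" using c U by (auto simp: connected_by_def)
  ultimately show ?thesis unfolding connected_by_def by blast
qed

text \<open>
  The groups must be the level sets of \<open>x\<close> on \<open>V\<close>; the rest is the injective case applied to
  the groups.
\<close>

lemma fits_ex1:
  assumes fin: "finite V" and c: "connected_by m V x"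
  shows "\<exists>!q. q \<in> struct (blocked_lists m) V \<and> fits m q x"
proof -
  define level where "level u = {v \<in> V. x v = x u}" for u
  define \<rho> where "\<rho> = level ` V"
  define y where "y C = x (SOME v. v \<in> C)" for C
  have p: "partition_on V \<rho>"
    by (rule partition_onI) (auto simp: \<rho>_def level_def disjnt_def)
  have y_level: "y (level u) = x u" if "u \<in> V" for u
  proof -
    define w where "w = (SOME v. v \<in> level u)"
    have "u \<in> level u" using that by (simp add: level_def)
    then have "w \<in> level u" unfolding w_def by (rule someI)
    then have "x w = x u" by (simp add: level_def)
    then show ?thesis by (simp add: y_def w_def)
  qed
  have xy: "x v = y C" if "C \<in> \<rho>" "v \<in> C" for C v
    using that y_level by (auto simp: \<rho>_def level_def)
  have inj: "inj_on y \<rho>"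
    unfolding \<rho>_def using y_level by (auto intro!: inj_onI simp: level_def)
  have path: "(level u, level v) \<in> (linked m \<rho> y)\<^sup>*" if "(u, v) \<in> (linked m V x)\<^sup>*" for u v
    using that
  proof induction
    case (step v w)
    then have "(level v, level w) \<in> linked m \<rho> y"
      using y_level by (auto simp: linked_def \<rho>_def)
    then show ?case using step(3) by (rule rtrancl_into_rtrancl[rotated])
  qed simp
  have cy: "connected_by m \<rho> y"
    using c path unfolding connected_by_def \<rho>_def by auto
  have ex1: "\<exists>!h. h \<in> struct (nested_lists m) \<rho> \<and> placed m h y"
    by (rule placed_ex1[OF finite_elements[OF fin p] cy inj])
  then obtain h where h: "h \<in> struct (nested_lists m) \<rho>" "placed m h y" by blast
  show ?thesis
  proof (rule ex1I[of _ "(\<rho>, h, \<lambda>C\<in>\<rho>. C)"])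
    show "(\<rho>, h, \<lambda>C\<in>\<rho>. C) \<in> struct (blocked_lists m) V \<and> fits m (\<rho>, h, \<lambda>C\<in>\<rho>. C) x"
      unfolding blocked_lists_mem fits_iff using p h xy by blast
    fix q assume "q \<in> struct (blocked_lists m) V \<and> fits m q x"
    then have q: "q \<in> struct (blocked_lists m) V" "fits m q x" by auto
    obtain \<rho>' h' where q': "q = (\<rho>', h', \<lambda>C\<in>\<rho>'. C)" "partition_on V \<rho>'"
      "h' \<in> struct (nested_lists m) \<rho>'"
      using q(1) by (rule blocked_listsE)
    obtain y' where y': "placed m h' y'" "\<forall>C\<in>\<rho>'. \<forall>v\<in>C. x v = y' C"
      using q(2) unfolding q'(1) fits_iff by blast
    have inj': "inj_on y' \<rho>'" using placed_connected[OF q'(3) y'(1)] ..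
    have U: "\<Union>\<rho>' = V" "{} \<notin> \<rho>'" using q'(2) by (auto simp: partition_on_def)
    have lev: "C = level u" if C: "C \<in> \<rho>'" "u \<in> C" for C u
    proof
      show "C \<subseteq> level u" using y'(2) C U by (auto simp: level_def)
      show "level u \<subseteq> C"
      proof
        fix v assume "v \<in> level u"
        then have v: "v \<in> V" "x v = x u" by (auto simp: level_def)
        then obtain D where D: "D \<in> \<rho>'" "v \<in> D" using U by blast
        then have "y' D = y' C" using y'(2) C v by auto
        then show "v \<in> C" using inj' D C by (auto dest: inj_onD)
      qed
    qed
    have eq: "\<rho>' = \<rho>"
    proof
      show "\<rho>' \<subseteq> \<rho>"
      proof
        fix C assume C: "C \<in> \<rho>'"
        then obtain u where "u \<in> C" using U by (metis all_not_in_conv)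
        then show "C \<in> \<rho>" using lev C U unfolding \<rho>_def by blast
      qed
      show "\<rho> \<subseteq> \<rho>'" unfolding \<rho>_def using lev U by blast
    qed
    have "y C = y' C + 0" if C: "C \<in> \<rho>" for C
    proof -
      obtain u where "u \<in> C" using C U eq by (metis all_not_in_conv)
      then show ?thesis using xy[OF C] y'(2) C eq by simp
    qed
    then have "placed m h' y" using placed_translate[OF q'(3) y'(1), of y 0] eq by blast
    then have "h' = h" using ex1 h q'(3) eq by blast
    then show "q = (\<rho>, h, \<lambda>C\<in>\<rho>. C)" using q'(1) eq by simp
  qed
qed

text \<open>
  A placement of the groups in \<open>V\<close> and one of their images under \<open>\<sigma>\<close> determine each other, since
  \<open>\<sigma>\<close> acts injectively on the groups.
\<close>

lemma fits_transport:
  assumes "q \<in> struct (blocked_lists m) V" "inj_on \<sigma> V"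
  shows "fits m (transport (blocked_lists m) V \<sigma> q) x \<longleftrightarrow> fits m q (x \<circ> \<sigma>)"
proof -
  obtain \<rho> h where q: "q = (\<rho>, h, \<lambda>C\<in>\<rho>. C)" "partition_on V \<rho>" "h \<in> struct (nested_lists m) \<rho>"
    using assms(1) by (rule blocked_listsE)
  have inj: "inj_on ((`) \<sigma>) \<rho>" by (rule inj_on_image_blocks[OF assms(2) q(2)])
  obtain e where e: "transport (blocked_lists m) V \<sigma> q =
      ((`) \<sigma> ` \<rho>, transport (nested_lists m) \<rho> ((`) \<sigma>) h, e)"
    unfolding q(1) by (rule subst_transport[OF assms(2) q(2)])
  have "(\<exists>y. placed m h (y \<circ> (`) \<sigma>) \<and> (\<forall>C\<in>\<rho>. \<forall>v\<in>C. x (\<sigma> v) = y (\<sigma> ` C))) \<longleftrightarrow>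
    (\<exists>y. placed m h y \<and> (\<forall>C\<in>\<rho>. \<forall>v\<in>C. x (\<sigma> v) = y C))" (is "?l \<longleftrightarrow> ?r")
  proof
    assume ?l
    then obtain y where y: "placed m h (y \<circ> (`) \<sigma>)" "\<forall>C\<in>\<rho>. \<forall>v\<in>C. x (\<sigma> v) = y (\<sigma> ` C)" by blast
    then show ?r by (intro exI[of _ "y \<circ> (`) \<sigma>"]) simp
  next
    assume ?r
    then obtain y where y: "placed m h y" "\<forall>C\<in>\<rho>. \<forall>v\<in>C. x (\<sigma> v) = y C" by blast
    let ?y = "y \<circ> inv_into \<rho> ((`) \<sigma>)"
    have *: "?y (\<sigma> ` C) = y C" if "C \<in> \<rho>" for C using inj that by simp
    have "placed m h (?y \<circ> (`) \<sigma>)"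
      using placed_translate[OF q(3) y(1), of "?y \<circ> (`) \<sigma>" 0] * by simp
    then show ?l using * y(2) by (intro exI[of _ ?y]) simp
  qed
  then show ?thesis
    unfolding e unfolding q(1) fits_iff placed_transport[OF q(3) inj] by simp
qed

section \<open>Flats as spaces of rigidly moving blocks\<close>

lemma space_on_iff: "x \<in> space_on V \<longleftrightarrow> (\<forall>v. v \<notin> V \<longrightarrow> Poly_Mapping.lookup x v = 0)"
  unfolding space_on_def by (auto simp: in_keys_iff subset_iff)

definition point :: "'a set \<Rightarrow> ('a \<Rightarrow> real) \<Rightarrow> ('a \<Rightarrow>\<^sub>0 real)" where
  "point V p = Abs_poly_mapping (\<lambda>v. if v \<in> V then p v else 0)"

lemma lookup_point:
  assumes "finite V"
  shows "Poly_Mapping.lookup (point V p) v = (if v \<in> V then p v else 0)"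
  unfolding point_def
  by (subst lookup_Abs_poly_mapping) (auto intro: finite_subset[OF _ assms])

lemma point_in_space_on: "finite V \<Longrightarrow> point V p \<in> space_on V"
  by (simp add: space_on_iff lookup_point)

lemma lookup_scaleR: "Poly_Mapping.lookup (r *\<^sub>R x) v = r *\<^sub>R Poly_Mapping.lookup x v"
  unfolding scaleR_poly_mapping_def
  by (subst lookup_Abs_poly_mapping) (auto intro: finite_subset[OF _ finite_lookup[of x]])

text \<open>
  For a partition \<open>\<pi>\<close> of \<open>V\<close>: all points obtained from \<open>x\<close> by translating each block of \<open>\<pi>\<close> independently.
\<close>

definition rigid_flat :: "'a set \<Rightarrow> 'a set set \<Rightarrow> ('a \<Rightarrow>\<^sub>0 real) \<Rightarrow> ('a \<Rightarrow>\<^sub>0 real) set" where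
  "rigid_flat V \<pi> x =
     {z \<in> space_on V. \<forall>B\<in>\<pi>. \<forall>u\<in>B. \<forall>v\<in>B.
        Poly_Mapping.lookup z u - Poly_Mapping.lookup z v =
        Poly_Mapping.lookup x u - Poly_Mapping.lookup x v}"

lemma rigid_flat_self: "x \<in> space_on V \<Longrightarrow> x \<in> rigid_flat V \<pi> x"
  by (simp add: rigid_flat_def)

lemma diff_constant_along_path:
  fixes x z :: "'a \<Rightarrow> real"
  assumes "(u, v) \<in> r\<^sup>*" "\<And>p q. (p, q) \<in> r \<Longrightarrow> z p - z q = x p - x q"
  shows "z u - z v = x u - x v"
  using assms(1)
proof induction
  case (step v w)
  then show ?case using assms(2)[of v w] by simp
qed simp

lemma hyperplane_swap: "hyperplane V u v a = hyperplane V v u (- a)"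
  unfolding hyperplane_def by auto

text \<open>
  The hyperplanes through \<open>x\<close> given by links inside blocks cut out this set, because along a
  path of links all differences inside a block are fixed.
\<close>

lemma rigid_flat_is_flat:
  assumes p: "partition_on V \<pi>" and x: "x \<in> space_on V"
    and c: "\<forall>B\<in>\<pi>. connected_by m B (Poly_Mapping.lookup x)"
  shows "rigid_flat V \<pi> x \<in> flats (space_on V) (catalan_arrangement m V)"
proof -
  let ?x = "Poly_Mapping.lookup x"
  define \<H> where "\<H> = {hyperplane V u v a | u v a. \<exists>B\<in>\<pi>. u \<in> B \<and> v \<in> B \<and> u \<noteq> v \<and>
    - int m \<le> a \<and> a \<le> int m \<and> ?x u - ?x v = of_int a}"
  have "\<H> \<subseteq> catalan_arrangement m V"
    unfolding \<H>_def catalan_arrangement_def using partition_block[OF p] by blast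
  moreover have "rigid_flat V \<pi> x = space_on V \<inter> \<Inter>\<H>"
  proof (intro equalityI subsetI)
    fix z assume z: "z \<in> rigid_flat V \<pi> x"
    have "z \<in> H" if H: "H \<in> \<H>" for H
    proof -
      obtain u v a B where "H = hyperplane V u v a" "B \<in> \<pi>" "u \<in> B" "v \<in> B"
        "?x u - ?x v = of_int a" using H unfolding \<H>_def by blast
      then show ?thesis using z by (simp add: rigid_flat_def hyperplane_def)
    qed
    then show "z \<in> space_on V \<inter> \<Inter>\<H>" using z by (auto simp: rigid_flat_def)
  next
    fix z assume z: "z \<in> space_on V \<inter> \<Inter>\<H>"
    let ?z = "Poly_Mapping.lookup z"
    have "?z u - ?z v = ?x u - ?x v" if B: "B \<in> \<pi>" "u \<in> B" "v \<in> B" for B u v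
    proof (rule diff_constant_along_path)
      show "(u, v) \<in> (linked m B ?x)\<^sup>*" using c B by (auto simp: connected_by_def)
      fix p q assume pq: "(p, q) \<in> linked m B ?x"
      show "?z p - ?z q = ?x p - ?x q"
      proof (cases "p = q")
        case False
        obtain a where a: "p \<in> B" "q \<in> B" "\<bar>a\<bar> \<le> int m" "?x p - ?x q = of_int a"
          using pq by (auto simp: linked_def)
        have "- int m \<le> a" "a \<le> int m" using a(3) by linarith+
        then have "hyperplane V p q a \<in> \<H>" unfolding \<H>_def using a B(1) False by blast
        then have "z \<in> hyperplane V p q a" using z by blast
        then show ?thesis using a(4) by (simp add: hyperplane_def)
      qed simp
    qed
    then show "z \<in> rigid_flat V \<pi> x" using z by (auto simp: rigid_flat_def)
  qed
  ultimately show ?thesis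
    unfolding flats_def using rigid_flat_self[OF x] by blast
qed

text \<open>
  Any point \<open>x\<close> of the flat serves as reference point. The blocks are the components of the graph
  whose edges are the pairs \<open>u, v\<close> for which some hyperplane \<open>x\<^sub>u - x\<^sub>v = a\<close> belongs to the family.
  These edges are links for \<open>x\<close>, so the blocks are connected; other links of \<open>x\<close> may be
  accidental and must not be used.
\<close>

lemma flat_is_rigid_flat:
  assumes "X \<in> flats (space_on V) (catalan_arrangement m V)"
  obtains \<pi> x where "partition_on V \<pi>" "x \<in> space_on V"
    "\<forall>B\<in>\<pi>. connected_by m B (Poly_Mapping.lookup x)" "X = rigid_flat V \<pi> x"
proof -
  obtain \<H> where H: "\<H> \<subseteq> catalan_arrangement m V" "X = space_on V \<inter> \<Inter>\<H>" and "X \<noteq> {}"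
    using assms by (auto simp: flats_def)
  then obtain x where x: "x \<in> X" by blast
  let ?x = "Poly_Mapping.lookup x"
  define r where "r = {(u, v). u \<in> V \<and> v \<in> V \<and>
    (\<exists>a. - int m \<le> a \<and> a \<le> int m \<and> hyperplane V u v a \<in> \<H>)}"
  have diff: "Poly_Mapping.lookup z u - Poly_Mapping.lookup z v = of_int a"
    if "z \<in> X" "hyperplane V u v a \<in> \<H>" for z u v a
    using that H(2) by (auto simp: hyperplane_def)
  have r: "r \<subseteq> linked m V ?x"
  proof clarify
    fix u v assume "(u, v) \<in> r"
    then obtain a where a: "u \<in> V" "v \<in> V" "- int m \<le> a" "a \<le> int m" "hyperplane V u v a \<in> \<H>"
      by (auto simp: r_def)
    then have "\<bar>a\<bar> \<le> int m" "?x u - ?x v = of_int a" using diff[OF x] by auto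
    then show "(u, v) \<in> linked m V ?x" using a by (auto simp: linked_def)
  qed
  have sym: "sym r"
  proof (rule symI)
    fix u v assume "(u, v) \<in> r"
    then obtain a where a: "u \<in> V" "v \<in> V" "- int m \<le> a" "a \<le> int m" "hyperplane V u v a \<in> \<H>"
      by (auto simp: r_def)
    then have "hyperplane V v u (- a) \<in> \<H>" "- int m \<le> - a" "- a \<le> int m"
      using hyperplane_swap[of V u v a] by auto
    then show "(v, u) \<in> r" using a unfolding r_def by blast
  qed
  have rV: "r \<subseteq> V \<times> V" by (auto simp: r_def)
  let ?\<pi> = "components r V"
  have p: "partition_on V ?\<pi>" by (rule partition_on_components[OF rV sym])
  have "X = rigid_flat V ?\<pi> x"
  proof (intro equalityI subsetI)
    fix z assume z: "z \<in> X"
    let ?z = "Poly_Mapping.lookup z"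
    have "?z u - ?z v = ?x u - ?x v" if B: "B \<in> ?\<pi>" "u \<in> B" "v \<in> B" for B u v
    proof (rule diff_constant_along_path)
      show "(u, v) \<in> (r \<inter> B \<times> B)\<^sup>*" by (rule component_connected[OF rV sym B])
      fix p q assume "(p, q) \<in> r \<inter> B \<times> B"
      then obtain a where "hyperplane V p q a \<in> \<H>" by (auto simp: r_def)
      then show "?z p - ?z q = ?x p - ?x q" using diff[OF x] diff[OF z] by simp
    qed
    then show "z \<in> rigid_flat V ?\<pi> x" using z H(2) by (auto simp: rigid_flat_def)
  next
    fix z assume z: "z \<in> rigid_flat V ?\<pi> x"
    have "z \<in> h" if h: "h \<in> \<H>" for h
    proof -
      obtain u v a where a: "h = hyperplane V u v a" "u \<in> V" "v \<in> V" "- int m \<le> a" "a \<le> int m"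
        using h H(1) by (auto simp: catalan_arrangement_def)
      then have uv: "(u, v) \<in> r" using h unfolding r_def by blast
      have "u \<in> r\<^sup>* `` {u}" "v \<in> r\<^sup>* `` {u}" "r\<^sup>* `` {u} \<in> ?\<pi>"
        using uv a(2) by (auto simp: components_def)
      then have "Poly_Mapping.lookup z u - Poly_Mapping.lookup z v = ?x u - ?x v"
        using z unfolding rigid_flat_def by blast
      also have "\<dots> = of_int a" using diff[OF x] h a(1) by simp
      finally show ?thesis using z a(1) by (simp add: hyperplane_def rigid_flat_def)
    qed
    then show "z \<in> X" using z H(2) by (auto simp: rigid_flat_def)
  qed
  moreover have "\<forall>B\<in>?\<pi>. connected_by m B ?x"
    using connected_by_component[OF r sym] by blast
  moreover have "x \<in> space_on V" using x H(2) by blast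
  ultimately show ?thesis using that[OF p] by blast
qed

text \<open>
  The block of \<open>u\<close> is read off from the flat as the set of labels whose difference to \<open>u\<close> is
  constant on the flat.
\<close>

lemma rigid_flat_block:
  assumes fin: "finite V" and p: "partition_on V \<pi>" and x: "x \<in> space_on V" and B: "B \<in> \<pi>" "u \<in> B"
  shows "B = {v \<in> V. \<forall>z\<in>rigid_flat V \<pi> x. \<forall>w\<in>rigid_flat V \<pi> x.
    Poly_Mapping.lookup z u - Poly_Mapping.lookup z v =
    Poly_Mapping.lookup w u - Poly_Mapping.lookup w v}" (is "B = ?C")
proof
  show "B \<subseteq> ?C"
    using B partition_block[OF p B(1)] by (auto simp: rigid_flat_def)
  show "?C \<subseteq> B"
  proof
    fix v assume v: "v \<in> ?C"
    show "v \<in> B"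
    proof (rule ccontr)
      assume nB: "v \<notin> B"
      \<comment> \<open>Moving the block of \<open>u\<close> alone stays in the flat and changes the difference to \<open>v\<close>.\<close>
      let ?z = "x + point B (\<lambda>_. 1)"
      have fB: "finite B" using partition_block[OF p B(1)] fin by (rule finite_subset)
      have l: "Poly_Mapping.lookup ?z w = Poly_Mapping.lookup x w + (if w \<in> B then 1 else 0)" for w
        by (simp add: lookup_add lookup_point[OF fB])
      have "?z \<in> rigid_flat V \<pi> x"
        unfolding rigid_flat_def
      proof (intro CollectI conjI ballI)
        show "?z \<in> space_on V"
          using x partition_block[OF p B(1)] unfolding space_on_iff l by auto
        fix C a b assume C: "C \<in> \<pi>" "a \<in> C" "b \<in> C"
        have "a \<in> B \<longleftrightarrow> b \<in> B"
          using p B(1) C unfolding partition_on_def disjoint_def by blast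
        then show "Poly_Mapping.lookup ?z a - Poly_Mapping.lookup ?z b =
          Poly_Mapping.lookup x a - Poly_Mapping.lookup x b" unfolding l by simp
      qed
      then have "Poly_Mapping.lookup ?z u - Poly_Mapping.lookup ?z v =
          Poly_Mapping.lookup x u - Poly_Mapping.lookup x v"
        using v rigid_flat_self[OF x] by blast
      then show False using B(2) nB unfolding l by simp
    qed
  qed
qed

lemma rigid_flat_eq_partition:
  assumes "finite V" "partition_on V \<pi>" "partition_on V \<pi>'" "x \<in> space_on V" "x' \<in> space_on V"
    and eq: "rigid_flat V \<pi> x = rigid_flat V \<pi>' x'"
  shows "\<pi> = \<pi>'"
proof -
  have sub: "\<rho> \<subseteq> \<rho>'" if \<rho>: "partition_on V \<rho>" "partition_on V \<rho>'" "y \<in> space_on V" "y' \<in> space_on V"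
    "rigid_flat V \<rho> y = rigid_flat V \<rho>' y'" for \<rho> \<rho>' y y'
  proof
    fix B assume B: "B \<in> \<rho>"
    then obtain u where u: "u \<in> B" using \<rho>(1) by (metis partition_onD3 all_not_in_conv)
    have "u \<in> \<Union>\<rho>'" using partition_block[OF \<rho>(1) B] u partition_onD1[OF \<rho>(2)] by blast
    then obtain C where C: "C \<in> \<rho>'" "u \<in> C" by blast
    have "B = C"
      using rigid_flat_block[OF assms(1) \<rho>(1,3) B u] rigid_flat_block[OF assms(1) \<rho>(2,4) C] \<rho>(5)
      by simp
    then show "B \<in> \<rho>'" using C by simp
  qed
  show ?thesis
    using sub[OF assms(2-6)] sub[OF assms(3,2,5,4) eq[symmetric]] by (rule equalityI)
qed

text \<open>
  The direction space consists of the functions that are constant on each block; the indicators of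
  the blocks form a basis of it.
\<close>

lemma flat_dim_rigid_flat:
  assumes fin: "finite V" and p: "partition_on V \<pi>" and x: "x \<in> space_on V"
  shows "flat_dim (rigid_flat V \<pi> x) = card \<pi>"
proof -
  define ind where "ind B = point B (\<lambda>_. 1)" for B :: "'a set"
  define D where "D = {z \<in> space_on V. \<forall>B\<in>\<pi>. \<forall>u\<in>B. \<forall>v\<in>B.
    Poly_Mapping.lookup z u = Poly_Mapping.lookup z v}"
  have f\<pi>: "finite \<pi>" by (rule finite_elements[OF fin p])
  have U: "\<Union>\<pi> = V" "{} \<notin> \<pi>" using p by (auto simp: partition_on_def)
  have same: "C = B" if "B \<in> \<pi>" "C \<in> \<pi>" "v \<in> B" "v \<in> C" for B C v
    using p that by (auto simp: partition_on_def disjoint_def)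
  have l: "Poly_Mapping.lookup (ind B) v = (if v \<in> B then 1 else 0)" if "B \<in> \<pi>" for B v
    unfolding ind_def by (rule lookup_point[OF finite_subset[OF partition_block[OF p that] fin]])
  have lsum: "Poly_Mapping.lookup (\<Sum>C\<in>\<pi>. c C *\<^sub>R ind C) v = c B"
    if B: "B \<in> \<pi>" "v \<in> B" for c B v
  proof -
    have "Poly_Mapping.lookup (\<Sum>C\<in>\<pi>. c C *\<^sub>R ind C) v = (\<Sum>C\<in>\<pi>. if C = B then c C else 0)"
      unfolding lookup_sum
    proof (rule sum.cong)
      fix C assume C: "C \<in> \<pi>"
      have "v \<in> C \<longleftrightarrow> C = B" using same[OF B(1) C B(2)] B(2) by blast
      then show "Poly_Mapping.lookup (c C *\<^sub>R ind C) v = (if C = B then c C else 0)"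
        by (simp add: lookup_scaleR l[OF C])
    qed simp
    then show ?thesis using f\<pi> B by simp
  qed
  have dir: "{z - w | z w. z \<in> rigid_flat V \<pi> x \<and> w \<in> rigid_flat V \<pi> x} = D" (is "?L = D")
  proof (intro equalityI subsetI)
    fix d assume "d \<in> ?L"
    then obtain z w where zw: "d = z - w" "z \<in> rigid_flat V \<pi> x" "w \<in> rigid_flat V \<pi> x" by blast
    show "d \<in> D"
      unfolding D_def
    proof (intro CollectI conjI ballI)
      show "d \<in> space_on V" using zw by (simp add: rigid_flat_def space_on_iff lookup_minus)
      fix B u v assume "B \<in> \<pi>" "u \<in> B" "v \<in> B"
      then have "Poly_Mapping.lookup z u - Poly_Mapping.lookup z v =
        Poly_Mapping.lookup w u - Poly_Mapping.lookup w v"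
        using zw(2,3) by (simp add: rigid_flat_def)
      then show "Poly_Mapping.lookup d u = Poly_Mapping.lookup d v"
        by (simp add: zw(1) lookup_minus)
    qed
  next
    fix d assume d: "d \<in> D"
    have "x + d \<in> rigid_flat V \<pi> x"
      unfolding rigid_flat_def
    proof (intro CollectI conjI ballI)
      show "x + d \<in> space_on V" using d x by (simp add: D_def space_on_iff lookup_add)
      fix B u v assume "B \<in> \<pi>" "u \<in> B" "v \<in> B"
      then have "Poly_Mapping.lookup d u = Poly_Mapping.lookup d v" using d unfolding D_def by blast
      then show "Poly_Mapping.lookup (x + d) u - Poly_Mapping.lookup (x + d) v =
        Poly_Mapping.lookup x u - Poly_Mapping.lookup x v" by (simp add: lookup_add)
    qed
    then show "d \<in> ?L" using rigid_flat_self[OF x] by (intro CollectI exI[of _ "x + d"] exI[of _ x]) simp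
  qed
  have inj: "inj_on ind \<pi>"
  proof (rule inj_onI)
    fix B C assume BC: "B \<in> \<pi>" "C \<in> \<pi>" "ind B = ind C"
    obtain v where v: "v \<in> B" using BC U by (metis all_not_in_conv)
    then have "v \<in> C" using l[OF BC(1), of v] l[OF BC(2), of v] BC(3) by (auto split: if_splits)
    then show "B = C" using same BC v by blast
  qed
  have sum_ind: "(\<Sum>b\<in>ind ` \<pi>. c b *\<^sub>R b) = (\<Sum>B\<in>\<pi>. c (ind B) *\<^sub>R ind B)" for c
    by (simp add: sum.reindex[OF inj])
  have "dim D = card \<pi>"
  proof (rule dim_unique[of "ind ` \<pi>"])
    show "ind ` \<pi> \<subseteq> D"
    proof clarify
      fix B assume B: "B \<in> \<pi>"
      have "Poly_Mapping.lookup (ind B) u = Poly_Mapping.lookup (ind B) v"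
        if "C \<in> \<pi>" "u \<in> C" "v \<in> C" for C u v
      proof -
        have "u \<in> B \<longleftrightarrow> v \<in> B" using same[OF B that(1)] that by blast
        then show ?thesis unfolding l[OF B] by simp
      qed
      moreover have "ind B \<in> space_on V"
        using partition_block[OF p B] unfolding space_on_iff l[OF B] by auto
      ultimately show "ind B \<in> D" unfolding D_def by blast
    qed
    show "D \<subseteq> span (ind ` \<pi>)"
    proof
      fix d assume d: "d \<in> D"
      define c where "c B = Poly_Mapping.lookup d (SOME v. v \<in> B)" for B
      have "d = (\<Sum>B\<in>\<pi>. c B *\<^sub>R ind B)"
      proof (rule poly_mapping_eqI)
        fix v
        show "Poly_Mapping.lookup d v = Poly_Mapping.lookup (\<Sum>B\<in>\<pi>. c B *\<^sub>R ind B) v"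
        proof (cases "v \<in> V")
          case True
          then obtain B where B: "B \<in> \<pi>" "v \<in> B" using U by blast
          then have "(SOME v. v \<in> B) \<in> B" by (auto intro: someI)
          then have "Poly_Mapping.lookup d v = c B" using d B unfolding c_def D_def by blast
          then show ?thesis using lsum[OF B] by simp
        next
          case False
          then have "Poly_Mapping.lookup (\<Sum>B\<in>\<pi>. c B *\<^sub>R ind B) v = 0"
            unfolding lookup_sum by (intro sum.neutral) (use l U in \<open>auto simp: lookup_scaleR\<close>)
          then show ?thesis using False d by (simp add: D_def space_on_iff)
        qed
      qed
      then show "d \<in> span (ind ` \<pi>)"
        by (simp only:) (intro span_sum span_scale span_base imageI)
    qed
    show "independent (ind ` \<pi>)"
      unfolding dependent_finite[OF finite_imageI[OF f\<pi>]] sum_ind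
    proof clarify
      fix c B assume c: "(\<Sum>B\<in>\<pi>. c (ind B) *\<^sub>R ind B) = 0" and B: "B \<in> \<pi>" and "c (ind B) \<noteq> 0"
      obtain v where "v \<in> B" using B U by (metis all_not_in_conv)
      then have "c (ind B) = 0" using lsum[OF B, of v "\<lambda>B. c (ind B)"] c by simp
      then show False using \<open>c (ind B) \<noteq> 0\<close> by simp
    qed
    show "card (ind ` \<pi>) = card \<pi>" by (rule card_image[OF inj])
  qed
  then show ?thesis unfolding flat_dim_def dir .
qed

section \<open>The natural isomorphisms\<close>

abbreviation block_assemblies where
  "block_assemblies m \<equiv> set_species \<circ>\<^sub>S blocked_lists m"

definition realization where
  "realization m V = (\<lambda>(\<pi>, f, g).
     {x \<in> space_on V. \<forall>B\<in>\<pi>. fits m (g B) (Poly_Mapping.lookup x)})"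

text \<open>
  Functor laws can be carried along natural bijections. Starting from the known species of
  structures, this yields at once that flats form a species and that the two are isomorphic.
\<close>

lemma species_iso_reverseI:
  assumes G: "species G"
    and bij: "\<And>V. finite V \<Longrightarrow> bij_betw (\<theta> V) (struct G V) (struct F V)"
    and nat: "\<And>V W \<sigma> s. finite V \<Longrightarrow> bij_betw \<sigma> V W \<Longrightarrow> s \<in> struct G V \<Longrightarrow>
      \<theta> W (transport G V \<sigma> s) = transport F V \<sigma> (\<theta> V s)"
  shows "F \<cong>\<^sub>S G"
proof -
  have el: "\<exists>s. s \<in> struct G V \<and> t = \<theta> V s" if "finite V" "t \<in> struct F V" for V t
    using bij[OF that(1)] that(2) by (auto simp: bij_betw_def)
  have mem: "\<theta> V s \<in> struct F V" if "finite V" "s \<in> struct G V" for V s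
    using bij_betwE[OF bij[OF that(1)]] that(2) by blast
  have "species F"
    unfolding species_def
  proof (intro conjI allI impI)
    show "finite (struct F V)" if "finite V" for V
      using bij_betw_finite[OF bij[OF that]] species_finite[OF G that] by blast
    show "transport F V \<sigma> t \<in> struct F W"
      if V: "finite V" and b: "bij_betw \<sigma> V W" and t: "t \<in> struct F V" for V W \<sigma> t
    proof -
      obtain s where s: "s \<in> struct G V" "t = \<theta> V s" using el[OF V t] by blast
      have "finite W" using bij_betw_finite[OF b] V by simp
      then show ?thesis
        unfolding s(2) nat[OF V b s(1), symmetric] by (intro mem species_mem[OF G V b s(1)])
    qed
    show "transport F V \<sigma> t = transport F V \<tau> t"
      if V: "finite V" and i: "inj_on \<sigma> V" and eq: "\<forall>v\<in>V. \<sigma> v = \<tau> v" and t: "t \<in> struct F V"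
      for V \<sigma> \<tau> t
    proof -
      obtain s where s: "s \<in> struct G V" "t = \<theta> V s" using el[OF V t] by blast
      have b: "bij_betw \<sigma> V (\<sigma> ` V)" "bij_betw \<tau> V (\<sigma> ` V)"
        using i bij_betw_cong[of V \<sigma> \<tau> "\<sigma> ` V"] eq by (auto simp: bij_betw_def)
      show ?thesis
        unfolding s(2) nat[OF V b(1) s(1), symmetric] nat[OF V b(2) s(1), symmetric]
        using species_cong[OF G V i _ s(1), of \<tau>] eq by simp
    qed
    show "transport F V id t = t" if V: "finite V" and t: "t \<in> struct F V" for V t
    proof -
      obtain s where s: "s \<in> struct G V" "t = \<theta> V s" using el[OF V t] by blast
      show ?thesis
        unfolding s(2) nat[OF V bij_betw_id s(1), symmetric] species_id[OF G V s(1)] ..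
    qed
    show "transport F V (\<tau> \<circ> \<sigma>) t = transport F W \<tau> (transport F V \<sigma> t)"
      if V: "finite V" and b: "bij_betw \<sigma> V W" and c: "bij_betw \<tau> W X" and t: "t \<in> struct F V"
      for V W X \<sigma> \<tau> t
    proof -
      obtain s where s: "s \<in> struct G V" "t = \<theta> V s" using el[OF V t] by blast
      have W: "finite W" using bij_betw_finite[OF b] V by simp
      show ?thesis
        unfolding s(2) nat[OF V b s(1), symmetric] nat[OF V bij_betw_trans[OF b c] s(1), symmetric]
          nat[OF W c species_mem[OF G V b s(1)], symmetric] species_comp[OF G V b c s(1)] ..
    qed
  qed
  moreover have "natural_iso F G (\<lambda>V. inv_into (struct G V) (\<theta> V))"
    unfolding natural_iso_def
  proof (intro conjI allI impI)
    fix V :: "'a set" assume V: "finite V"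
    show "bij_betw (inv_into (struct G V) (\<theta> V)) (struct F V) (struct G V)"
      by (rule bij_betw_inv_into[OF bij[OF V]])
    fix W :: "'a set" and \<sigma> t assume b: "bij_betw \<sigma> V W" and t: "t \<in> struct F V"
    obtain s where s: "s \<in> struct G V" "t = \<theta> V s" using el[OF V t] by blast
    have W: "finite W" using bij_betw_finite[OF b] V by simp
    show "inv_into (struct G W) (\<theta> W) (transport F V \<sigma> t) =
      transport G V \<sigma> (inv_into (struct G V) (\<theta> V) t)"
      unfolding s(2) nat[OF V b s(1), symmetric]
        bij_betw_inv_into_left[OF bij[OF V] s(1)]
        bij_betw_inv_into_left[OF bij[OF W] species_mem[OF G V b s(1)]] ..
  qed
  ultimately show ?thesis unfolding species_iso_def using G by blast
qed

lemma block_assemblies_mem: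
  "s \<in> struct (block_assemblies m) V \<longleftrightarrow>
     (\<exists>\<pi> g. s = (\<pi>, \<pi>, g) \<and> partition_on V \<pi> \<and> g \<in> (\<Pi>\<^sub>E B\<in>\<pi>. struct (blocked_lists m) B))"
  by (cases s) (auto simp: subst_mem set_species_def)

lemma realization_iff:
  "x \<in> realization m V (\<pi>, f, g) \<longleftrightarrow>
     x \<in> space_on V \<and> (\<forall>B\<in>\<pi>. fits m (g B) (Poly_Mapping.lookup x))"
  by (simp add: realization_def)

lemma realization_point:
  assumes fin: "finite V" and p: "partition_on V \<pi>"
    and g: "g \<in> (\<Pi>\<^sub>E B\<in>\<pi>. struct (blocked_lists m) B)"
  obtains x where "x \<in> space_on V" "\<forall>B\<in>\<pi>. fits m (g B) (Poly_Mapping.lookup x)"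
proof -
  have gB: "g B \<in> struct (blocked_lists m) B" if "B \<in> \<pi>" for B using g that by auto
  have "\<forall>B\<in>\<pi>. \<exists>y. fits m (g B) y"
    using fits_exists gB finite_subset[OF partition_block[OF p] fin] by blast
  then obtain y where y: "\<forall>B\<in>\<pi>. fits m (g B) (y B)" by metis
  obtain z where z: "\<And>B v. B \<in> \<pi> \<Longrightarrow> v \<in> B \<Longrightarrow> z v = y B v"
    using extend_over_blocks[OF p, of y] by blast
  have "fits m (g B) (Poly_Mapping.lookup (point V z))" if B: "B \<in> \<pi>" for B
  proof (rule fits_translate[OF gB[OF B]])
    show "fits m (g B) (y B)" using y B by blast
    show "\<forall>v\<in>B. Poly_Mapping.lookup (point V z) v = y B v + 0"
      using partition_block[OF p B] z[OF B] by (auto simp: lookup_point[OF fin])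
  qed
  then show ?thesis using that point_in_space_on[OF fin] by blast
qed

text \<open>
  On each block the described configurations form a single orbit under translation, so any one
  described point generates the whole set by moving the blocks.
\<close>

lemma realization_rigid_flat:
  assumes p: "partition_on V \<pi>" and g: "g \<in> (\<Pi>\<^sub>E B\<in>\<pi>. struct (blocked_lists m) B)"
    and x: "x \<in> space_on V" "\<forall>B\<in>\<pi>. fits m (g B) (Poly_Mapping.lookup x)"
  shows "realization m V (\<pi>, f, g) = rigid_flat V \<pi> x"
proof -
  let ?x = "Poly_Mapping.lookup x"
  have "fits m (g B) (Poly_Mapping.lookup z) \<longleftrightarrow>
    (\<forall>u\<in>B. \<forall>v\<in>B. Poly_Mapping.lookup z u - Poly_Mapping.lookup z v = ?x u - ?x v)"
    (is "?l \<longleftrightarrow> ?r") if B: "B \<in> \<pi>" for B z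
  proof
    have gB: "g B \<in> struct (blocked_lists m) B" using g B by auto
    have xB: "fits m (g B) ?x" using x B by blast
    show ?r if l: ?l
    proof -
      obtain t where "\<forall>v\<in>B. Poly_Mapping.lookup z v = ?x v + t"
        using fits_unique[OF gB xB l] ..
      then show ?thesis by simp
    qed
    show ?l if r: ?r
    proof -
      obtain u where u: "u \<in> B" using B partition_onD3[OF p] by (metis all_not_in_conv)
      have "\<forall>v\<in>B. Poly_Mapping.lookup z v = ?x v + (Poly_Mapping.lookup z u - ?x u)"
      proof
        fix v assume "v \<in> B"
        with r u have "Poly_Mapping.lookup z v - Poly_Mapping.lookup z u = ?x v - ?x u" by blast
        then show "Poly_Mapping.lookup z v = ?x v + (Poly_Mapping.lookup z u - ?x u)" by simp
      qed
      then show ?thesis by (rule fits_translate[OF gB xB])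
    qed
  qed
  then show ?thesis by (auto simp: realization_iff rigid_flat_def)
qed

lemma block_assemblyE:
  assumes fin: "finite V" and s: "s \<in> struct (block_assemblies m) V"
  obtains \<pi> g x where "s = (\<pi>, \<pi>, g)" "partition_on V \<pi>"
    "g \<in> (\<Pi>\<^sub>E B\<in>\<pi>. struct (blocked_lists m) B)" "x \<in> space_on V"
    "\<forall>B\<in>\<pi>. fits m (g B) (Poly_Mapping.lookup x)" "realization m V s = rigid_flat V \<pi> x"
proof -
  obtain \<pi> g where s': "s = (\<pi>, \<pi>, g)" "partition_on V \<pi>"
    "g \<in> (\<Pi>\<^sub>E B\<in>\<pi>. struct (blocked_lists m) B)"
    using s unfolding block_assemblies_mem by blast
  obtain x where x: "x \<in> space_on V" "\<forall>B\<in>\<pi>. fits m (g B) (Poly_Mapping.lookup x)"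
    using realization_point[OF fin s'(2,3)] by blast
  have "realization m V s = rigid_flat V \<pi> x"
    unfolding s'(1) by (rule realization_rigid_flat[OF s'(2,3) x])
  then show ?thesis by (rule that[OF s' x])
qed

lemma flat_dim_realization:
  assumes "finite V" "s \<in> struct (block_assemblies m) V"
  shows "flat_dim (realization m V s) = card (fst s)"
proof -
  obtain \<pi> g x where "s = (\<pi>, \<pi>, g)" "partition_on V \<pi>" "x \<in> space_on V"
    "realization m V s = rigid_flat V \<pi> x"
    using assms by (rule block_assemblyE)
  then show ?thesis using flat_dim_rigid_flat[OF assms(1)] by simp
qed

text \<open>
  Injectivity: the flat determines the outer partition, and any common point determines the
  structure on each block. Surjectivity: a flat moves the blocks of some partition from a
  reference point that is connected on each of them, and such a configuration is described by a
  structure on the block.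
\<close>

lemma bij_betw_realization:
  assumes fin: "finite V"
  shows "bij_betw (realization m V) (struct (block_assemblies m) V)
    (flats (space_on V) (catalan_arrangement m V))"
  unfolding bij_betw_def
proof (intro conjI)
  show "inj_on (realization m V) (struct (block_assemblies m) V)"
  proof (rule inj_onI)
    fix s s' assume s: "s \<in> struct (block_assemblies m) V" and s': "s' \<in> struct (block_assemblies m) V"
      and eq: "realization m V s = realization m V s'"
    obtain \<pi> g x where 1: "s = (\<pi>, \<pi>, g)" "partition_on V \<pi>"
      "g \<in> (\<Pi>\<^sub>E B\<in>\<pi>. struct (blocked_lists m) B)" "x \<in> space_on V"
      "\<forall>B\<in>\<pi>. fits m (g B) (Poly_Mapping.lookup x)" "realization m V s = rigid_flat V \<pi> x"
      using fin s by (rule block_assemblyE)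
    obtain \<pi>' g' x' where 2: "s' = (\<pi>', \<pi>', g')" "partition_on V \<pi>'"
      "g' \<in> (\<Pi>\<^sub>E B\<in>\<pi>'. struct (blocked_lists m) B)" "x' \<in> space_on V"
      "\<forall>B\<in>\<pi>'. fits m (g' B) (Poly_Mapping.lookup x')" "realization m V s' = rigid_flat V \<pi>' x'"
      using fin s' by (rule block_assemblyE)
    have \<pi>: "\<pi> = \<pi>'"
      using rigid_flat_eq_partition[OF fin 1(2) 2(2) 1(4) 2(4)] 1(6) 2(6) eq by simp
    have "x \<in> realization m V s'" using 1(4,5) 1(1) eq realization_iff by metis
    then have x: "\<forall>B\<in>\<pi>. fits m (g' B) (Poly_Mapping.lookup x)"
      unfolding 2(1) realization_iff \<pi> by blast
    have "g = g'"
    proof (rule extensionalityI[of _ \<pi>])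
      show "g \<in> extensional \<pi>" "g' \<in> extensional \<pi>" using 1(3) 2(3) \<pi> by (auto simp: PiE_def)
      fix B assume B: "B \<in> \<pi>"
      have "finite B" using partition_block[OF 1(2) B] fin by (rule finite_subset)
      moreover have gB: "g B \<in> struct (blocked_lists m) B" "g' B \<in> struct (blocked_lists m) B"
        using 1(3) 2(3) \<pi> B by auto
      moreover have "connected_by m B (Poly_Mapping.lookup x)"
        using fits_connected[OF gB(1)] 1(5) B by blast
      ultimately show "g B = g' B" using fits_ex1[of B m "Poly_Mapping.lookup x"] 1(5) x B by blast
    qed
    then show "s = s'" using 1(1) 2(1) \<pi> by simp
  qed
  show "realization m V ` struct (block_assemblies m) V = flats (space_on V) (catalan_arrangement m V)"
  proof (intro equalityI subsetI)
    fix X assume "X \<in> realization m V ` struct (block_assemblies m) V"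
    then obtain s where s: "s \<in> struct (block_assemblies m) V" "X = realization m V s" by blast
    obtain \<pi> g x where 1: "s = (\<pi>, \<pi>, g)" "partition_on V \<pi>"
      "g \<in> (\<Pi>\<^sub>E B\<in>\<pi>. struct (blocked_lists m) B)" "x \<in> space_on V"
      "\<forall>B\<in>\<pi>. fits m (g B) (Poly_Mapping.lookup x)" "realization m V s = rigid_flat V \<pi> x"
      using fin s(1) by (rule block_assemblyE)
    have "\<forall>B\<in>\<pi>. connected_by m B (Poly_Mapping.lookup x)"
      using fits_connected 1(3,5) by blast
    then show "X \<in> flats (space_on V) (catalan_arrangement m V)"
      unfolding s(2) 1(6) using rigid_flat_is_flat[OF 1(2,4)] by blast
  next
    fix X assume "X \<in> flats (space_on V) (catalan_arrangement m V)"
    then obtain \<pi> x where X: "partition_on V \<pi>" "x \<in> space_on V"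
      "\<forall>B\<in>\<pi>. connected_by m B (Poly_Mapping.lookup x)" "X = rigid_flat V \<pi> x"
      by (rule flat_is_rigid_flat)
    define g where
      "g = (\<lambda>B\<in>\<pi>. THE q. q \<in> struct (blocked_lists m) B \<and> fits m q (Poly_Mapping.lookup x))"
    have g: "g B \<in> struct (blocked_lists m) B \<and> fits m (g B) (Poly_Mapping.lookup x)"
      if B: "B \<in> \<pi>" for B
      using theI'[OF fits_ex1[of B m "Poly_Mapping.lookup x"]] X(3) B
        finite_subset[OF partition_block[OF X(1) B] fin] by (simp add: g_def)
    then have g': "g \<in> (\<Pi>\<^sub>E B\<in>\<pi>. struct (blocked_lists m) B)" by (auto simp: g_def)
    then have "(\<pi>, \<pi>, g) \<in> struct (block_assemblies m) V"
      unfolding block_assemblies_mem using X(1) by blast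
    moreover have "X = realization m V (\<pi>, \<pi>, g)"
      unfolding X(4) by (rule realization_rigid_flat[OF X(1) g' X(2), symmetric]) (use g in blast)
    ultimately show "X \<in> realization m V ` struct (block_assemblies m) V" by blast
  qed
qed

lemma realization_transport:
  assumes fin: "finite V" and b: "bij_betw \<sigma> V W" and s: "s \<in> struct (block_assemblies m) V"
  shows "realization m W (transport (block_assemblies m) V \<sigma> s) = relabel V \<sigma> (realization m V s)"
proof -
  obtain \<pi> g where s': "s = (\<pi>, \<pi>, g)" "partition_on V \<pi>"
    "g \<in> (\<Pi>\<^sub>E B\<in>\<pi>. struct (blocked_lists m) B)"
    using s unfolding block_assemblies_mem by blast
  have i: "inj_on \<sigma> V" and W: "W = \<sigma> ` V" using b by (auto simp: bij_betw_def)
  obtain h where h: "transport (block_assemblies m) V \<sigma> s =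
      ((`) \<sigma> ` \<pi>, transport set_species \<pi> ((`) \<sigma>) \<pi>, h)"
    "\<And>B. B \<in> \<pi> \<Longrightarrow> h (\<sigma> ` B) = transport (blocked_lists m) B \<sigma> (g B)"
    using subst_transport[OF i s'(2), of set_species "blocked_lists m" \<pi> g] unfolding s'(1) by metis
  have gB: "g B \<in> struct (blocked_lists m) B" if "B \<in> \<pi>" for B using s'(3) that by auto
  have fit: "fits m (h (\<sigma> ` B)) y \<longleftrightarrow> fits m (g B) x"
    if B: "B \<in> \<pi>" and xy: "\<forall>v\<in>V. y (\<sigma> v) = x v" for B x y
  proof -
    have BV: "B \<subseteq> V" by (rule partition_block[OF s'(2) B])
    have "fits m (h (\<sigma> ` B)) y \<longleftrightarrow> fits m (g B) (y \<circ> \<sigma>)"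
      unfolding h(2)[OF B] by (rule fits_transport[OF gB[OF B] inj_on_subset[OF i BV]])
    also have "\<dots> \<longleftrightarrow> fits m (g B) x"
    proof -
      have "\<forall>v\<in>B. x v = (y \<circ> \<sigma>) v + 0" "\<forall>v\<in>B. (y \<circ> \<sigma>) v = x v + 0" using xy BV by auto
      then show ?thesis using fits_translate[OF gB[OF B]] by blast
    qed
    finally show ?thesis .
  qed
  show ?thesis
  proof (intro equalityI subsetI)
    fix y assume "y \<in> realization m W (transport (block_assemblies m) V \<sigma> s)"
    then have y: "y \<in> space_on W" "\<forall>B\<in>\<pi>. fits m (h (\<sigma> ` B)) (Poly_Mapping.lookup y)"
      unfolding h(1) realization_iff by auto
    let ?x = "point V (Poly_Mapping.lookup y \<circ> \<sigma>)"
    have xy: "\<forall>v\<in>V. Poly_Mapping.lookup y (\<sigma> v) = Poly_Mapping.lookup ?x v"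
      by (simp add: lookup_point[OF fin])
    have "?x \<in> realization m V s"
      unfolding s'(1) realization_iff using point_in_space_on[OF fin] fit[OF _ xy] y(2) by blast
    then show "y \<in> relabel V \<sigma> (realization m V s)"
      unfolding relabel_def using y(1) W xy by blast
  next
    fix y assume "y \<in> relabel V \<sigma> (realization m V s)"
    then obtain x where y: "y \<in> space_on W" and x: "x \<in> realization m V s"
      and xy: "\<forall>v\<in>V. Poly_Mapping.lookup y (\<sigma> v) = Poly_Mapping.lookup x v"
      unfolding relabel_def W by blast
    then show "y \<in> realization m W (transport (block_assemblies m) V \<sigma> s)"
      unfolding h(1) unfolding s'(1) realization_iff using fit[OF _ xy] by blast
  qed
qed

text \<open>
  The structure of the outer species at \<open>\<pi>\<close> is \<open>\<pi>\<close> itself, so restricting the outer species to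
  \<open>k\<close> points restricts the number of blocks, which is the dimension of the flat.
\<close>

lemma of_card_subst:
  "struct (of_card k set_species \<circ>\<^sub>S G) V = {s \<in> struct (set_species \<circ>\<^sub>S G) V. card (fst s) = k}"
  "transport (of_card k set_species \<circ>\<^sub>S G) = transport (set_species \<circ>\<^sub>S G)"
  by (auto simp: subst_def of_card_def split: if_splits)

theorem theorem1p11:
  fixes m k :: nat
  shows "(catalan_flats_of_dim k m :: ('a, ('a \<Rightarrow>\<^sub>0 real) set) species)
           \<cong>\<^sub>S of_card k set_species \<circ>\<^sub>S iterate (nonempty list_species) m \<circ>\<^sub>S nonempty set_species
       \<and> (catalan_flats m :: ('a, ('a \<Rightarrow>\<^sub>0 real) set) species)
           \<cong>\<^sub>S set_species \<circ>\<^sub>S iterate (nonempty list_species) m \<circ>\<^sub>S nonempty set_species"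
proof
  have sp: "species (blocked_lists m :: ('a, _) species)"
    by (intro species_subst species_iterate species_nonempty species_list species_set)
  show "(catalan_flats m :: ('a, ('a \<Rightarrow>\<^sub>0 real) set) species) \<cong>\<^sub>S block_assemblies m"
  proof (rule species_iso_reverseI[where \<theta> = "realization m"])
    show "species (block_assemblies m :: ('a, _) species)"
      by (intro species_subst species_set sp)
  qed (simp_all add: catalan_flats_def bij_betw_realization realization_transport)
  show "(catalan_flats_of_dim k m :: ('a, ('a \<Rightarrow>\<^sub>0 real) set) species)
    \<cong>\<^sub>S of_card k set_species \<circ>\<^sub>S blocked_lists m"
  proof (rule species_iso_reverseI[where \<theta> = "realization m"])
    show "species (of_card k set_species \<circ>\<^sub>S blocked_lists m :: ('a, _) species)"
      by (intro species_subst species_of_card species_set sp)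
    fix V :: "'a set" assume V: "finite V"
    show "bij_betw (realization m V) (struct (of_card k set_species \<circ>\<^sub>S blocked_lists m) V)
      (struct (catalan_flats_of_dim k m) V)"
    proof -
      let ?S = "struct (block_assemblies m) V"
      have im: "realization m V ` ?S = flats (space_on V) (catalan_arrangement m V)"
        and inj: "inj_on (realization m V) ?S"
        using bij_betw_realization[OF V, of m] by (auto simp: bij_betw_def)
      have "realization m V ` {s \<in> ?S. card (fst s) = k} =
        {X \<in> realization m V ` ?S. flat_dim X = k}"
        using flat_dim_realization[OF V] by force
      then show ?thesis
        unfolding bij_betw_def of_card_subst catalan_flats_of_dim_def species.simps im
        using inj by (auto intro: inj_on_subset)
    qed
    fix W :: "'a set" and \<sigma> s assume "bij_betw \<sigma> V W" "s \<in> struct (of_card k set_species \<circ>\<^sub>S blocked_lists m) V"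
    then show "realization m W (transport (of_card k set_species \<circ>\<^sub>S blocked_lists m) V \<sigma> s) =
      transport (catalan_flats_of_dim k m) V \<sigma> (realization m V s)"
      unfolding of_card_subst using realization_transport[OF V]
      by (simp add: catalan_flats_of_dim_def)
  qed
qed

end
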